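(* Let $\Omega\subset\mathbb{R}^n$ be open and bounded. Let $\alpha$, $r$ and $p$ be bounded and $\log$-Hölder continuous functions on $\Omega$, with $p^->1$, $r^-\ge1$, $0<\alpha^-\le\alpha^+<n$, $(\alpha pr)^+<n$, and $p(x)\ge 1+\frac1{r(x)}-\frac{\alpha(x)}{n}$ for every $x\in\Omega$. If $f\in L^{r(\cdot)}(\Omega)$, then the function $x\mapsto\mathcal{W}^f_{\alpha(x),p(x)}(x)$ belongs to $$w\text{-}L^{\frac{nr(\cdot)(p(\cdot)-1)}{n-\alpha(\cdot)p(\cdot)r(\cdot)}}(\Omega).$$
   Context: For measurable $g$ write $g^-:=\operatorname{ess\,inf}_\Omega g$, $g^+:=\operatorname{ess\,sup}_\Omega g$. A bounded function $g$ on the bounded set $\Omega$ is $\log$-Hölder continuous if there is $c>0$ with $|g(x)-g(y)|\le\frac{c}{\log(e+1/|x-y|)}$ for all $x,y\in\Omega$. $L^{s(\cdot)}(\Omega)$: measurable $f$ with $\int_\Omega|f(x)|^{s(x)}dx<\infty$, with Luxemburg (quasi-)norm $\|f\|_{L^{s(\cdot)}(\Omega)}:=\inf\{\lambda>0:\int_\Omega|f/\lambda|^{s(x)}dx\le1\}$. Weak space $w\text{-}L^{s(\cdot)}(\Omega)$: measurable $f$ with $\sup_{\lambda>0}\lambda\|\chi_{\{|f|>\lambda\}}\|_{L^{s(\cdot)}(\Omega)}<\infty$. Wolff potential (with $f$ extended by zero outside $\Omega$): $$\mathcal{W}^f_{\alpha(x),p(x)}(x):=\int_0^\infty\left(\frac{\int_{B(x,\rho)}|f(y)|\,dy}{\rho^{\,n-\alpha(x)p(x)}}\right)^{1/(p(x)-1)}\frac{d\rho}{\rho}.$$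 *)

theory Defs
  imports "HOL-Analysis.Analysis" "HOL-Probability.Essential_Supremum"
begin

text \<open>
  Functions in the variable exponent spaces are extended-real-valued, since the Wolff potential
  may be infinite on a null set. Functions on \<open>\<Omega>\<close> are total functions whose values outside
  \<open>\<Omega>\<close> are ignored; measurability is Lebesgue measurability on \<open>\<Omega>\<close>.
\<close>

definition essinf :: "'a measure \<Rightarrow> ('a \<Rightarrow> ereal) \<Rightarrow> ereal" where
  "essinf M g = Sup {z. AE x in M. z \<le> g x}"

definition ess_inf_on :: "'a::euclidean_space set \<Rightarrow> ('a \<Rightarrow> real) \<Rightarrow> ereal" where
  "ess_inf_on \<Omega> g = essinf (lebesgue_on \<Omega>) (\<lambda>x. ereal (g x))"

definition ess_sup_on :: "'a::euclidean_space set \<Rightarrow> ('a \<Rightarrow> real) \<Rightarrow> ereal" where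
  "ess_sup_on \<Omega> g = esssup (lebesgue_on \<Omega>) (\<lambda>x. ereal (g x))"

text \<open>At \<open>x = y\<close> both sides make sense: the left-hand side is \<open>0\<close>, and the convention
  \<open>1 / 0 = 0\<close> turns the right-hand side into \<open>c\<close>.\<close>

definition log_holder_on :: "'a::euclidean_space set \<Rightarrow> ('a \<Rightarrow> real) \<Rightarrow> bool" where
  "log_holder_on \<Omega> g \<longleftrightarrow>
     (\<exists>c>0. \<forall>x\<in>\<Omega>. \<forall>y\<in>\<Omega>. \<bar>g x - g y\<bar> \<le> c / ln (exp 1 + 1 / norm (x - y)))"

text \<open>Powers on \<open>[0, \<infinity>]\<close>; the value at infinity is the right one for positive exponents,
  the only ones for which it is used.\<close>

definition epowr :: "ennreal \<Rightarrow> real \<Rightarrow> ennreal" where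
  "epowr x s = (if x = top then top else ennreal (enn2real x powr s))"

definition var_modular :: "'a::euclidean_space set \<Rightarrow> ('a \<Rightarrow> real) \<Rightarrow> ('a \<Rightarrow> ereal) \<Rightarrow> ennreal" where
  "var_modular \<Omega> s f = (\<integral>\<^sup>+x. epowr (e2ennreal \<bar>f x\<bar>) (s x) \<partial>lebesgue_on \<Omega>)"

definition var_Lebesgue :: "'a::euclidean_space set \<Rightarrow> ('a \<Rightarrow> real) \<Rightarrow> ('a \<Rightarrow> ereal) set" where
  "var_Lebesgue \<Omega> s = {f. f \<in> borel_measurable (lebesgue_on \<Omega>) \<and> var_modular \<Omega> s f < \<infinity>}"

text \<open>The infimum over the empty set is \<open>\<infinity>\<close>.\<close>

definition luxemburg_norm :: "'a::euclidean_space set \<Rightarrow> ('a \<Rightarrow> real) \<Rightarrow> ('a \<Rightarrow> ereal) \<Rightarrow> ennreal" where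
  "luxemburg_norm \<Omega> s f =
     Inf {ennreal l | l. l > 0 \<and> var_modular \<Omega> s (\<lambda>x. f x / ereal l) \<le> 1}"

definition weak_var_Lebesgue :: "'a::euclidean_space set \<Rightarrow> ('a \<Rightarrow> real) \<Rightarrow> ('a \<Rightarrow> ereal) set" where
  "weak_var_Lebesgue \<Omega> s = {f. f \<in> borel_measurable (lebesgue_on \<Omega>) \<and>
     (SUP l\<in>{0<..}. ennreal l * luxemburg_norm \<Omega> s (indicator {x\<in>\<Omega>. \<bar>f x\<bar> > ereal l})) < \<infinity>}"

definition zero_extend :: "'a set \<Rightarrow> ('a \<Rightarrow> ereal) \<Rightarrow> 'a \<Rightarrow> ereal" where
  "zero_extend \<Omega> f = (\<lambda>x. if x \<in> \<Omega> then f x else 0)"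

text \<open>Here \<open>a\<close> and \<open>q\<close> are the values of the exponents \<open>\<alpha>\<close> and \<open>p\<close> at the point \<open>x\<close>.\<close>

definition wolff_potential :: "('a::euclidean_space \<Rightarrow> ereal) \<Rightarrow> real \<Rightarrow> real \<Rightarrow> 'a \<Rightarrow> ennreal" where
  "wolff_potential f a q x =
     (\<integral>\<^sup>+\<rho>\<in>{0<..}.
        epowr ((\<integral>\<^sup>+y\<in>ball x \<rho>. e2ennreal \<bar>f y\<bar> \<partial>lebesgue) / ennreal (\<rho> powr (real DIM('a) - a * q)))
              (1 / (q - 1))
        / ennreal \<rho> \<partial>lebesgue)"

end

theory Submission
  imports Defs
begin

text \<open>
  Write \<open>n\<close> for the dimension, \<open>G(y) = |f(y)|\<^bsup>r(y)\<^esup>\<close> on \<open>\<Omega>\<close> and \<open>G = 0\<close> elsewhere, so that \<open>G\<close> is integrable,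
  and \<open>q = n r (p - 1) / (n - \<alpha> p r)\<close> for the target exponent. The assertion amounts to a bound of
  \<open>\<integral>\<close> over \<open>{W > c t}\<close> of \<open>t\<^bsup>q(x)\<^esup>\<close> that is uniform in \<open>t > 0\<close>, where \<open>W\<close> is the Wolff potential and \<open>c\<close> a
  constant (\<open>weak_var_Lebesgue_memI\<close>). For \<open>t < 1\<close> it is trivial because \<open>\<Omega>\<close> has finite measure. For
  \<open>t \<ge> 1\<close> the proof combines a pointwise and a covering argument.

  Pointwise, Hedberg's trick applies with the exponents frozen at \<open>x\<close>. If every ball \<open>B(x,\<rho>)\<close> satisfies
  \<open>\<integral>G \<le> t\<^bsup>q(x)\<^esup> \<rho>\<^bsup>n\<^esup>\<close>, then the mass of \<open>f\<close> on it is at most a constant times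
  \<open>t\<^bsup>q(x)/r(x)\<^esup> \<rho>\<^bsup>n\<^esup>\<close>, and in any case at most a constant times \<open>\<rho>\<^bsup>n - n/r(x)\<^esup>\<close>. The first bound is
  inserted into \<open>W\<close> for small radii, the second one for large radii, and the optimal splitting radius
  gives \<open>W(x) \<le> c t\<close> (\<open>wolff_potential_le_of_modular_density\<close>). Hence every point with \<open>W(x) > c t\<close> is the
  centre of a ball with \<open>\<integral>G > t\<^bsup>q(x)\<^esup> \<rho>\<^bsup>n\<^esup>\<close>. Measuring
  concentration by the density of \<open>G\<close> instead of the maximal function of \<open>f\<close> makes the case
  that \<open>r\<close> touches \<open>1\<close> no different: only a weak-type bound for the integrable function \<open>G\<close> remains.

  A Vitali covering by such balls bounds the integral of \<open>t\<^bsup>q(x)\<^esup>\<close> over \<open>{W > c t}\<close> by a constant times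
  \<open>\<integral>G\<close> (\<open>variable_exponent_weak_type\<close>).

  Both arguments replace a variable exponent by its value at the centre of a ball of radius \<open>\<rho>\<close>. This
  costs only a constant factor, since the bases that occur are at most polynomial in \<open>1/\<rho>\<close> and the
  exponents are log-Hoelder continuous (\<open>log_holder_powr_comparable\<close>).
\<close>

section \<open>Log-Hoelder continuous exponents\<close>

lemma ln_exp_1_add_ge_1:
  fixes t :: real
  assumes "t \<ge> 0"
  shows "ln (exp 1 + t) \<ge> 1"
proof -
  have "ln (exp 1 :: real) \<le> ln (exp 1 + t)"
    using assms by (intro ln_mono) (auto intro: add_pos_nonneg)
  then show ?thesis by simp
qed

lemma log_holder_on_dominated:
  fixes f g h :: "'a::euclidean_space \<Rightarrow> real"
  assumes "log_holder_on \<Omega> f" and "log_holder_on \<Omega> g" and "A \<ge> 0"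
    and h: "\<And>x y. x \<in> \<Omega> \<Longrightarrow> y \<in> \<Omega> \<Longrightarrow> \<bar>h x - h y\<bar> \<le> A * (\<bar>f x - f y\<bar> + \<bar>g x - g y\<bar>)"
  shows "log_holder_on \<Omega> h"
proof -
  from assms(1) obtain c where c: "c > 0"
      "\<And>x y. x \<in> \<Omega> \<Longrightarrow> y \<in> \<Omega> \<Longrightarrow> \<bar>f x - f y\<bar> \<le> c / ln (exp 1 + 1 / norm (x - y))"
    unfolding log_holder_on_def by blast
  from assms(2) obtain d where d: "d > 0"
      "\<And>x y. x \<in> \<Omega> \<Longrightarrow> y \<in> \<Omega> \<Longrightarrow> \<bar>g x - g y\<bar> \<le> d / ln (exp 1 + 1 / norm (x - y))"
    unfolding log_holder_on_def by blast
  have "\<bar>h x - h y\<bar> \<le> ((A + 1) * (c + d)) / ln (exp 1 + 1 / norm (x - y))"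
    if "x \<in> \<Omega>" "y \<in> \<Omega>" for x y
  proof -
    have L: "ln (exp 1 + 1 / norm (x - y)) > 0"
      using ln_exp_1_add_ge_1[of "1 / norm (x - y)"] by simp
    have "\<bar>h x - h y\<bar> \<le> A * (\<bar>f x - f y\<bar> + \<bar>g x - g y\<bar>)"
      using h that by blast
    also have "\<dots> \<le> (A + 1) * (c / ln (exp 1 + 1 / norm (x - y)) + d / ln (exp 1 + 1 / norm (x - y)))"
      using c(2)[OF that] d(2)[OF that] \<open>A \<ge> 0\<close> by (intro mult_mono add_mono) auto
    also have "\<dots> = ((A + 1) * (c + d)) / ln (exp 1 + 1 / norm (x - y))"
      by (simp add: add_divide_distrib distrib_left)
    finally show ?thesis .
  qed
  moreover have "(A + 1) * (c + d) > 0"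
    using c(1) d(1) \<open>A \<ge> 0\<close> by simp
  ultimately show ?thesis
    unfolding log_holder_on_def by blast
qed

lemma log_holder_on_mult:
  fixes f g :: "'a::euclidean_space \<Rightarrow> real"
  assumes "log_holder_on \<Omega> f" and "log_holder_on \<Omega> g"
    and "bounded (f ` \<Omega>)" and "bounded (g ` \<Omega>)"
  shows "log_holder_on \<Omega> (\<lambda>x. f x * g x)"
proof -
  from assms(3) obtain A where A: "A > 0" "\<And>x. x \<in> \<Omega> \<Longrightarrow> \<bar>f x\<bar> \<le> A"
    unfolding bounded_pos by auto
  from assms(4) obtain B where B: "B > 0" "\<And>x. x \<in> \<Omega> \<Longrightarrow> \<bar>g x\<bar> \<le> B"
    unfolding bounded_pos by auto
  show ?thesis
  proof (rule log_holder_on_dominated[OF assms(1,2)])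
    show "A + B \<ge> 0" using A B by simp
    fix x y assume xy: "x \<in> \<Omega>" "y \<in> \<Omega>"
    have "f x * g x - f y * g y = (f x - f y) * g x + f y * (g x - g y)"
      by (simp add: algebra_simps)
    then have "\<bar>f x * g x - f y * g y\<bar> \<le> \<bar>f x - f y\<bar> * \<bar>g x\<bar> + \<bar>f y\<bar> * \<bar>g x - g y\<bar>"
      by (metis abs_mult abs_triangle_ineq)
    also have "\<dots> \<le> \<bar>f x - f y\<bar> * (A + B) + (A + B) * \<bar>g x - g y\<bar>"
    proof -
      have "\<bar>g x\<bar> \<le> A + B" "\<bar>f y\<bar> \<le> A + B"
        using A(1) B(1) A(2)[OF xy(2)] B(2)[OF xy(1)] by linarith+
      then show ?thesis by (intro add_mono mult_left_mono mult_right_mono) auto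
    qed
    finally show "\<bar>f x * g x - f y * g y\<bar> \<le> (A + B) * (\<bar>f x - f y\<bar> + \<bar>g x - g y\<bar>)"
      by (simp add: algebra_simps)
  qed
qed

lemma log_holder_on_divide:
  fixes f g :: "'a::euclidean_space \<Rightarrow> real"
  assumes "log_holder_on \<Omega> f" and "log_holder_on \<Omega> g" and "bounded (f ` \<Omega>)"
    and "d > 0" and g: "\<And>x. x \<in> \<Omega> \<Longrightarrow> g x \<ge> d"
  shows "log_holder_on \<Omega> (\<lambda>x. f x / g x)"
proof -
  from assms(3) obtain A where A: "A > 0" "\<And>x. x \<in> \<Omega> \<Longrightarrow> \<bar>f x\<bar> \<le> A"
    unfolding bounded_pos by auto
  define B where "B = 1 / d + A / (d * d)"
  show ?thesis
  proof (rule log_holder_on_dominated[OF assms(1,2)])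
    show "B \<ge> 0" using A \<open>d > 0\<close> by (simp add: B_def)
    fix x y assume xy: "x \<in> \<Omega>" "y \<in> \<Omega>"
    have gp: "g x > 0" "g y > 0" "g x \<ge> d" "g y \<ge> d"
      using g xy \<open>d > 0\<close> by (force dest: g)+
    have "f x / g x - f y / g y = (f x - f y) / g x + f y * (g y - g x) / (g x * g y)"
      using gp by (simp add: field_simps)
    then have "\<bar>f x / g x - f y / g y\<bar> \<le> \<bar>(f x - f y) / g x\<bar> + \<bar>f y * (g y - g x) / (g x * g y)\<bar>"
      by (metis abs_triangle_ineq)
    also have "\<dots> = \<bar>f x - f y\<bar> / g x + \<bar>f y\<bar> * \<bar>g x - g y\<bar> / (g x * g y)"
      using gp by (simp add: abs_mult abs_minus_commute)
    also have "\<dots> \<le> \<bar>f x - f y\<bar> / d + A * \<bar>g x - g y\<bar> / (d * d)"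
      using gp A(2)[OF xy(2)] A(1) \<open>d > 0\<close> by (intro add_mono frac_le mult_mono) auto
    also have "\<dots> \<le> B * (\<bar>f x - f y\<bar> + \<bar>g x - g y\<bar>)"
      using A(1) \<open>d > 0\<close> by (simp add: B_def distrib_left distrib_right)
    finally show "\<bar>f x / g x - f y / g y\<bar> \<le> B * (\<bar>f x - f y\<bar> + \<bar>g x - g y\<bar>)" .
  qed
qed

lemma log_holder_on_imp_continuous_on:
  fixes g :: "'a::euclidean_space \<Rightarrow> real"
  assumes "log_holder_on \<Omega> g"
  shows "continuous_on \<Omega> g"
proof -
  from assms obtain c where c: "c > 0"
      "\<And>x y. x \<in> \<Omega> \<Longrightarrow> y \<in> \<Omega> \<Longrightarrow> \<bar>g x - g y\<bar> \<le> c / ln (exp 1 + 1 / norm (x - y))"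
    unfolding log_holder_on_def by blast
  show ?thesis unfolding continuous_on_iff
  proof (intro ballI allI impI)
    fix x and e :: real
    assume x: "x \<in> \<Omega>" and e: "e > 0"
    show "\<exists>\<delta>>0. \<forall>y\<in>\<Omega>. dist y x < \<delta> \<longrightarrow> dist (g y) (g x) < e"
    proof (intro exI[of _ "exp (- (c / e))"] conjI ballI impI)
      show "exp (- (c / e)) > 0" by simp
      fix y assume y: "y \<in> \<Omega>" and d: "dist y x < exp (- (c / e))"
      show "dist (g y) (g x) < e"
      proof (cases "y = x")
        case False
        define \<rho> where "\<rho> = norm (y - x)"
        have \<rho>: "\<rho> > 0" "\<rho> < exp (- (c / e))"
          using False d by (auto simp: \<rho>_def dist_norm)
        have "exp (c / e) = 1 / exp (- (c / e))"
          by (simp add: exp_minus divide_inverse)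
        also have "\<dots> < 1 / \<rho>"
          using \<rho> by (intro divide_strict_left_mono) auto
        also have "\<dots> < exp 1 + 1 / \<rho>" by simp
        finally have "ln (exp (c / e)) < ln (exp 1 + 1 / \<rho>)"
          using \<rho> by (subst ln_less_cancel_iff) (auto intro: add_pos_pos)
        then have "c / e < ln (exp 1 + 1 / \<rho>)" by simp
        then have "c / ln (exp 1 + 1 / \<rho>) < e"
          using c(1) e ln_exp_1_add_ge_1[of "1 / \<rho>"] \<rho> by (simp add: field_simps)
        then show ?thesis
          using c e c(2)[OF y x] by (simp add: dist_real_def \<rho>_def)
      qed (use e in simp)
    qed
  qed
qed

text \<open>
  This is the way in which log-Hoelder continuity enters: at distance \<open>\<rho>\<close> the exponent varies
  by \<open>O(1 / log (e + 1/\<rho>))\<close>, so a base of at most polynomial size in \<open>1/\<rho>\<close> may be raised to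
  either exponent with the same result up to a constant.
\<close>

lemma log_holder_powr_comparable:
  fixes g :: "'a::euclidean_space \<Rightarrow> real"
  assumes "log_holder_on \<Omega> g" and "M \<ge> 1" and "N \<ge> 0"
  obtains C where "C \<ge> 1"
    and "\<And>x y \<rho> T. x \<in> \<Omega> \<Longrightarrow> y \<in> \<Omega> \<Longrightarrow> dist x y \<le> \<rho> \<Longrightarrow> 0 < \<rho> \<Longrightarrow> 1 \<le> T \<Longrightarrow>
           T \<le> M * (exp 1 + 1 / \<rho>) powr N \<Longrightarrow> T powr g x \<le> C * T powr g y"
proof -
  from assms(1) obtain c where c: "c > 0"
      "\<And>x y. x \<in> \<Omega> \<Longrightarrow> y \<in> \<Omega> \<Longrightarrow> \<bar>g x - g y\<bar> \<le> c / ln (exp 1 + 1 / norm (x - y))"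
    unfolding log_holder_on_def by blast
  define K where "K = ln M + N"
  have K: "K \<ge> 0" using assms by (simp add: K_def)
  have main: "T powr g x \<le> exp (c * K) * T powr g y"
    if xy: "x \<in> \<Omega>" "y \<in> \<Omega>" and d: "dist x y \<le> \<rho>" and \<rho>: "0 < \<rho>" and T: "1 \<le> T"
      and TM: "T \<le> M * (exp 1 + 1 / \<rho>) powr N" for x y \<rho> T
  proof (cases "x = y")
    case True
    have "1 * T powr g y \<le> exp (c * K) * T powr g y"
      using c(1) K by (intro mult_right_mono) auto
    then show ?thesis using True by simp
  next
    case False
    define L where "L = ln (exp 1 + 1 / norm (x - y))"
    have d': "norm (x - y) > 0" "norm (x - y) \<le> \<rho>"
      using False d by (auto simp: dist_norm)
    have L1: "L \<ge> 1" unfolding L_def by (rule ln_exp_1_add_ge_1) simp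
    have "1 / \<rho> \<le> 1 / norm (x - y)" using d' \<rho> by (intro divide_left_mono) auto
    then have L\<rho>: "ln (exp 1 + 1 / \<rho>) \<le> L"
      unfolding L_def using \<rho> by (intro ln_mono) (auto intro: add_pos_pos)
    have pos: "exp 1 + 1 / \<rho> > 0" using \<rho> by (auto intro: add_pos_pos)
    have "ln T \<le> ln (M * (exp 1 + 1 / \<rho>) powr N)"
      using T TM by (intro ln_mono) auto
    also have "\<dots> = ln M + N * ln (exp 1 + 1 / \<rho>)"
      using pos assms by (subst ln_mult) (auto simp: ln_powr)
    also have "\<dots> \<le> ln M * L + N * L"
      using L1 L\<rho> assms by (intro add_mono mult_left_mono) (auto simp: mult_le_cancel_left1)
    finally have lnT: "ln T \<le> K * L" by (simp add: K_def algebra_simps)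
    have "(g x - g y) * ln T \<le> \<bar>g x - g y\<bar> * ln T"
      using T by (intro mult_right_mono) auto
    also have "\<dots> \<le> (c / L) * (K * L)"
      using c(2)[OF xy] lnT T L1 c(1) by (intro mult_mono) (auto simp: L_def)
    also have "\<dots> = c * K" using L1 by simp
    finally have "exp ((g x - g y) * ln T) \<le> exp (c * K)" by simp
    then have "T powr (g x - g y) \<le> exp (c * K)"
      using T by (simp add: powr_def)
    then have "T powr (g x - g y) * T powr g y \<le> exp (c * K) * T powr g y"
      by (intro mult_right_mono) auto
    then show ?thesis by (simp add: powr_add[symmetric])
  qed
  show thesis
    by (rule that[of "exp (c * K)"]) (use c K main in auto)
qed

section \<open>Essential bounds of continuous functions\<close>

text \<open>By continuity the bound fails on an open set if at all, and a nonempty open set is not null.\<close>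

lemma AE_ge_imp_ge_on_open:
  fixes g :: "'a::euclidean_space \<Rightarrow> real"
  assumes "open \<Omega>" and "continuous_on \<Omega> g"
    and ae: "AE x in lebesgue_on \<Omega>. z \<le> g x" and "x \<in> \<Omega>"
  shows "z \<le> g x"
proof (rule ccontr)
  assume "\<not> z \<le> g x"
  define U where "U = {x \<in> \<Omega>. g x < z}"
  have "U = g -` {..<z} \<inter> \<Omega>" by (auto simp: U_def)
  then have "open U"
    using assms(1,2) by (simp add: continuous_on_open_vimage)
  moreover have "U \<noteq> {}" using \<open>x \<in> \<Omega>\<close> \<open>\<not> z \<le> g x\<close> by (auto simp: U_def)
  ultimately have "\<not> negligible U" by (rule open_not_negligible)
  have "AE x in lebesgue. x \<in> \<Omega> \<longrightarrow> z \<le> g x"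
    using ae \<open>open \<Omega>\<close> by (subst (asm) AE_restrict_space_iff) auto
  then have "AE x in lebesgue. x \<notin> U"
    by eventually_elim (auto simp: U_def)
  then have "U \<in> null_sets lebesgue"
    using \<open>open U\<close> by (subst AE_iff_null_sets) auto
  then have "negligible U" by (simp add: negligible_iff_null_sets)
  with \<open>\<not> negligible U\<close> show False by contradiction
qed

lemma ess_inf_on_gt_imp_ge:
  fixes g :: "'a::euclidean_space \<Rightarrow> real"
  assumes "open \<Omega>" and "continuous_on \<Omega> g" and "ereal z < ess_inf_on \<Omega> g" and "x \<in> \<Omega>"
  shows "z \<le> g x"
proof -
  from assms(3) obtain w where "ereal z < w" and w: "AE x in lebesgue_on \<Omega>. w \<le> ereal (g x)"
    unfolding ess_inf_on_def essinf_def less_Sup_iff by blast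
  from w have "AE x in lebesgue_on \<Omega>. z \<le> g x"
  proof eventually_elim
    case (elim x)
    with \<open>ereal z < w\<close> have "ereal z \<le> ereal (g x)" by order
    then show ?case by simp
  qed
  then show ?thesis by (rule AE_ge_imp_ge_on_open[OF assms(1,2) _ assms(4)])
qed

lemma ess_sup_on_lt_imp_le:
  fixes g :: "'a::euclidean_space \<Rightarrow> real"
  assumes "open \<Omega>" and "continuous_on \<Omega> g" and "ess_sup_on \<Omega> g < ereal z" and "x \<in> \<Omega>"
  shows "g x \<le> z"
proof -
  have "AE x in lebesgue_on \<Omega>. ereal (g x) \<le> ess_sup_on \<Omega> g"
    unfolding ess_sup_on_def by (rule esssup_AE)
  then have "AE x in lebesgue_on \<Omega>. - z \<le> - g x"
  proof eventually_elim
    case (elim x)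
    with assms(3) have "ereal (g x) \<le> ereal z" by order
    then show ?case by simp
  qed
  then have "- z \<le> - g x"
    by (rule AE_ge_imp_ge_on_open[OF assms(1) _ _ assms(4), of "\<lambda>x. - g x", rotated])
       (intro continuous_intros assms)
  then show ?thesis by simp
qed

section \<open>Mass of balls in terms of the modular\<close>

lemma epowr_ennreal: "0 \<le> a \<Longrightarrow> epowr (ennreal a) s = ennreal (a powr s)"
  by (simp add: epowr_def)

lemma epowr_mono:
  assumes "x \<le> y" and "s \<ge> 0"
  shows "epowr x s \<le> epowr y s"
proof (cases "y = top")
  case False
  then have "x \<noteq> top" "enn2real x \<le> enn2real y"
    using assms(1) by (auto simp: top_unique less_top intro: enn2real_mono)
  with False show ?thesis
    using assms(2) by (auto simp: epowr_def intro!: ennreal_leI powr_mono2)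
qed (simp add: epowr_def)

lemma borel_measurable_epowr [measurable (raw)]:
  assumes [measurable]: "f \<in> borel_measurable M" "g \<in> borel_measurable M"
  shows "(\<lambda>x. epowr (f x) (g x)) \<in> borel_measurable M"
  unfolding epowr_def by measurable

lemma emeasure_lebesgue_ball:
  fixes x :: "'a::euclidean_space"
  assumes "\<rho> > 0"
  shows "emeasure lebesgue (ball x \<rho>)
    = ennreal (\<rho> powr real DIM('a) * measure lebesgue (ball (0::'a) 1))"
proof -
  have "emeasure lebesgue (ball x \<rho>) = ennreal (measure lebesgue (ball x \<rho>))"
    using emeasure_lborel_ball_finite[of x \<rho>] by (intro emeasure_eq_ennreal_measure) auto
  also have "measure lebesgue (ball x \<rho>) = \<rho> powr real DIM('a) * measure lebesgue (ball (0::'a) 1)"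
    using content_ball_conv_unit_ball[of \<rho> x] assms by (simp add: powr_realpow)
  finally show ?thesis .
qed

lemma one_add_divide_powr_le:
  fixes K \<nu> \<rho> N :: real
  assumes "0 \<le> \<nu>" and "\<nu> \<le> K" and "1 \<le> K" and "0 < \<rho>" and "0 \<le> N"
  shows "1 + \<nu> / \<rho> powr N \<le> 2 * K * (exp 1 + 1 / \<rho>) powr N"
proof -
  have e: "exp 1 + 1 / \<rho> \<ge> 1" "exp 1 + 1 / \<rho> \<ge> 1 / \<rho>"
    using assms(4) one_le_exp_iff[of "1::real"] by (simp_all add: add_increasing2)
  have "1 \<le> (exp 1 + 1 / \<rho>) powr N"
    using e assms by (intro ge_one_powr_ge_zero) auto
  then have "1 * 1 \<le> K * (exp 1 + 1 / \<rho>) powr N"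
    using assms by (intro mult_mono) auto
  moreover have "\<nu> / \<rho> powr N = \<nu> * (1 / \<rho>) powr N"
    using assms by (simp add: powr_divide)
  moreover have "\<nu> * (1 / \<rho>) powr N \<le> K * (exp 1 + 1 / \<rho>) powr N"
    using e assms by (intro mult_mono powr_mono2) auto
  ultimately show ?thesis by simp
qed

text \<open>
  A substitute for Jensen's inequality
  \<open>(\<integral>F / |B|)\<^bsup>r(x)\<^esup> \<le> C (1 + \<integral>F\<^bsup>r(y)\<^esup> / |B|)\<close> on balls \<open>B\<close> around \<open>x\<close>. With \<open>\<tau>\<close> chosen so that
  \<open>\<tau>\<^bsup>r(x)\<^esup>\<close> is the right-hand side, either \<open>F \<le> \<tau>\<close> or \<open>F \<le> \<tau> (F/\<tau>)\<^bsup>r(y)\<^esup>\<close>. Since \<open>\<tau>\<close> grows at most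
  polynomially in the inverse radius, \<open>\<tau>\<^bsup>r(y)\<^esup>\<close> may be replaced by \<open>\<tau>\<^bsup>r(x)\<^esup>\<close>, and integrating over \<open>B\<close>
  yields the bound.
\<close>

lemma log_holder_mass_bound:
  fixes r :: "'a::euclidean_space \<Rightarrow> real"
  assumes "log_holder_on \<Omega> r" and r1: "\<And>x. x \<in> \<Omega> \<Longrightarrow> r x \<ge> 1" and "K \<ge> 1"
  obtains A where "A > 0"
    and "\<And>F G x \<rho> \<nu>. F \<in> borel_measurable lebesgue \<Longrightarrow> G \<in> borel_measurable lebesgue \<Longrightarrow>
           (\<And>y. y \<notin> \<Omega> \<Longrightarrow> F y = 0) \<Longrightarrow> (\<And>y. y \<in> \<Omega> \<Longrightarrow> G y = epowr (F y) (r y)) \<Longrightarrow>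
           x \<in> \<Omega> \<Longrightarrow> 0 < \<rho> \<Longrightarrow> 0 \<le> \<nu> \<Longrightarrow> \<nu> \<le> K \<Longrightarrow>
           (\<integral>\<^sup>+y\<in>ball x \<rho>. G y \<partial>lebesgue) \<le> ennreal \<nu> \<Longrightarrow>
           (\<integral>\<^sup>+y\<in>ball x \<rho>. F y \<partial>lebesgue)
             \<le> ennreal (A * \<rho> powr real DIM('a) * (1 + \<nu> / \<rho> powr real DIM('a)) powr (1 / r x))"
proof -
  have K2: "2 * K \<ge> 1" using \<open>K \<ge> 1\<close> by simp
  from log_holder_powr_comparable[OF assms(1) K2, of "real DIM('a)", simplified]
  obtain C where C: "C \<ge> 1"
    and cmp: "\<And>x y \<rho> T. x \<in> \<Omega> \<Longrightarrow> y \<in> \<Omega> \<Longrightarrow> dist x y \<le> \<rho> \<Longrightarrow> 0 < \<rho> \<Longrightarrow> 1 \<le> T \<Longrightarrow>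
           T \<le> 2 * K * (exp 1 + 1 / \<rho>) powr real DIM('a) \<Longrightarrow> T powr r x \<le> C * T powr r y"
    by blast
  define V where "V = measure lebesgue (ball (0::'a) 1)"
  have "V \<ge> 0" by (simp add: V_def)
  have main: "(\<integral>\<^sup>+y\<in>ball x \<rho>. F y \<partial>lebesgue)
      \<le> ennreal ((V + C) * \<rho> powr real DIM('a) * (1 + \<nu> / \<rho> powr real DIM('a)) powr (1 / r x))"
    if [measurable]: "F \<in> borel_measurable lebesgue" "G \<in> borel_measurable lebesgue"
      and F0: "\<And>y. y \<notin> \<Omega> \<Longrightarrow> F y = 0" and G: "\<And>y. y \<in> \<Omega> \<Longrightarrow> G y = epowr (F y) (r y)"
      and x: "x \<in> \<Omega>" and \<rho>: "0 < \<rho>" and \<nu>: "0 \<le> \<nu>" "\<nu> \<le> K"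
      and G\<nu>: "(\<integral>\<^sup>+y\<in>ball x \<rho>. G y \<partial>lebesgue) \<le> ennreal \<nu>"
    for F G :: "'a \<Rightarrow> ennreal" and x \<rho> \<nu>
  proof -
    define \<rho>n where "\<rho>n = \<rho> powr real DIM('a)"
    have \<rho>n: "\<rho>n > 0" using \<rho> by (simp add: \<rho>n_def)
    define \<tau> where "\<tau> = (1 + \<nu> / \<rho>n) powr (1 / r x)"
    have base: "1 + \<nu> / \<rho>n \<ge> 1" using \<nu> \<rho>n by simp
    have rx: "r x \<ge> 1" using r1 x .
    have \<tau>1: "\<tau> \<ge> 1" unfolding \<tau>_def using base rx by (intro ge_one_powr_ge_zero) auto
    have "\<tau> \<le> (1 + \<nu> / \<rho>n) powr 1"
      unfolding \<tau>_def using base rx by (intro powr_mono) auto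
    also have "\<dots> = 1 + \<nu> / \<rho>n" using base by simp
    also have "\<dots> \<le> 2 * K * (exp 1 + 1 / \<rho>) powr real DIM('a)"
      unfolding \<rho>n_def using \<nu> \<rho> \<open>K \<ge> 1\<close> by (intro one_add_divide_powr_le) auto
    finally have \<tau>2: "\<tau> \<le> 2 * K * (exp 1 + 1 / \<rho>) powr real DIM('a)" .
    have \<tau>r: "\<tau> powr r x = 1 + \<nu> / \<rho>n"
      unfolding \<tau>_def using base rx by (simp add: powr_powr)
    define D where "D = C * \<tau> / \<tau> powr r x"
    have D: "D > 0" using C \<tau>1 by (simp add: D_def)
    have pw: "F y \<le> ennreal \<tau> + ennreal D * G y" if y: "y \<in> ball x \<rho>" for y
    proof (cases "y \<in> \<Omega>")
      case True
      show ?thesis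
      proof (cases "F y")
        case top
        then have "G y = top" using G[OF True] by (simp add: epowr_def)
        then show ?thesis using D by (simp add: ennreal_mult_top)
      next
        case (real a)
        show ?thesis
        proof (cases "a \<le> \<tau>")
          case True
          then show ?thesis using real by (simp add: add_increasing2)
        next
          case False
          then have a: "a > \<tau>" "a > 0" using \<tau>1 by auto
          have ry: "r y \<ge> 1" using r1 True .
          have "a = \<tau> * (a / \<tau>) powr 1" using a \<tau>1 by simp
          also have "\<dots> \<le> \<tau> * (a / \<tau>) powr r y"
            using a \<tau>1 ry by (intro mult_left_mono powr_mono) auto
          also have "\<dots> = \<tau> * a powr r y * (1 / \<tau> powr r y)"
            using a \<tau>1 by (simp add: powr_divide)
          also have "\<dots> \<le> \<tau> * a powr r y * (C / \<tau> powr r x)"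
          proof (intro mult_left_mono)
            have "\<tau> powr r x \<le> C * \<tau> powr r y"
              using cmp[OF x True _ \<rho> \<tau>1 \<tau>2] y by simp
            then show "1 / \<tau> powr r y \<le> C / \<tau> powr r x"
              using \<tau>1 by (simp add: field_simps)
          qed (use \<tau>1 in auto)
          also have "\<dots> = D * a powr r y" by (simp add: D_def)
          finally have "ennreal a \<le> ennreal (D * a powr r y)" by (rule ennreal_leI)
          also have "\<dots> = ennreal D * G y"
            using D real G[OF True] by (simp add: epowr_ennreal ennreal_mult)
          finally show ?thesis using real by (simp add: add_increasing)
        qed
      qed
    qed (simp add: F0)
    have [measurable]: "ball x \<rho> \<in> sets lebesgue" by simp
    have "(\<integral>\<^sup>+y\<in>ball x \<rho>. F y \<partial>lebesgue)
        \<le> (\<integral>\<^sup>+y. ennreal \<tau> * indicator (ball x \<rho>) y + ennreal D * (G y * indicator (ball x \<rho>) y) \<partial>lebesgue)"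
      using pw by (intro nn_integral_mono) (auto simp: indicator_def)
    also have "\<dots> = ennreal \<tau> * emeasure lebesgue (ball x \<rho>)
        + ennreal D * (\<integral>\<^sup>+y\<in>ball x \<rho>. G y \<partial>lebesgue)"
      by (subst nn_integral_add; (measurable)?) (simp add: nn_integral_cmult nn_integral_cmult_indicator)
    also have "\<dots> \<le> ennreal \<tau> * ennreal (\<rho>n * V) + ennreal D * ennreal \<nu>"
      unfolding emeasure_lebesgue_ball[OF \<rho>] \<rho>n_def V_def
      using G\<nu> by (intro add_left_mono mult_left_mono) auto
    also have "\<dots> = ennreal (\<tau> * (\<rho>n * V) + D * \<nu>)"
      using \<tau>1 \<rho>n \<open>V \<ge> 0\<close> D \<nu> by (simp add: ennreal_mult ennreal_plus)
    also have "\<dots> \<le> ennreal ((V + C) * \<rho>n * \<tau>)"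
    proof (rule ennreal_leI)
      have "D * \<nu> = C * \<tau> * (\<nu> / (1 + \<nu> / \<rho>n))" by (simp add: D_def \<tau>r)
      also have "\<dots> \<le> C * \<tau> * \<rho>n"
      proof (intro mult_left_mono)
        show "\<nu> / (1 + \<nu> / \<rho>n) \<le> \<rho>n" using \<nu> \<rho>n by (simp add: field_simps)
      qed (use C \<tau>1 in auto)
      finally show "\<tau> * (\<rho>n * V) + D * \<nu> \<le> (V + C) * \<rho>n * \<tau>" by (simp add: algebra_simps)
    qed
    finally show ?thesis by (simp add: \<rho>n_def \<tau>_def)
  qed
  show thesis
    by (rule that[of "V + C"]) (use C \<open>V \<ge> 0\<close> main in auto)
qed

section \<open>A Hedberg-type estimate of the Wolff potential\<close>

text \<open>
  The potential is split at the radius \<open>R\<close>. The first hypothesis is the better one for small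
  radii and gives a convergent integral near \<open>0\<close>; the second one does so near \<open>\<infinity>\<close>. They agree
  at \<open>\<rho> = R\<close>, so both parts are of the same size.
\<close>

lemma wolff_potential_le_of_mass_bounds:
  fixes u :: "'a::euclidean_space \<Rightarrow> ereal"
  assumes q: "q > 1" and A: "A > 0" and R: "R > 0" and aq: "0 < a * q" "a * q < k"
    and m1: "\<And>\<rho>. \<rho> > 0 \<Longrightarrow> (\<integral>\<^sup>+y\<in>ball x \<rho>. e2ennreal \<bar>u y\<bar> \<partial>lebesgue)
              \<le> ennreal (A * \<rho> powr real DIM('a) * R powr (- k))"
    and m2: "\<And>\<rho>. \<rho> > 0 \<Longrightarrow> (\<integral>\<^sup>+y\<in>ball x \<rho>. e2ennreal \<bar>u y\<bar> \<partial>lebesgue)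
              \<le> ennreal (A * \<rho> powr (real DIM('a) - k))"
  shows "wolff_potential u a q x
    \<le> ennreal (A powr (1 / (q - 1)) * ((q - 1) / (a * q) + (q - 1) / (k - a * q))
                * R powr (- ((k - a * q) / (q - 1))))"
proof -
  define e where "e = 1 / (q - 1)"
  define b where "b = a * q"
  define n where "n = real DIM('a)"
  have e: "e > 0" using q by (simp add: e_def)
  have b: "0 < b" "b < k" using aq by (auto simp: b_def)
  have be: "0 < b * e" "0 < (k - b) * e" using b e by auto
  define m where "m \<rho> = (\<integral>\<^sup>+y\<in>ball x \<rho>. e2ennreal \<bar>u y\<bar> \<partial>lebesgue)" for \<rho>
  define c1 where "c1 = (A * R powr (- k)) powr e"
  define c2 where "c2 = A powr e"
  have near: "epowr (m \<rho> / ennreal (\<rho> powr (n - b))) e / ennreal \<rho> \<le> ennreal (c1 * \<rho> powr (b * e - 1))"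
    if "\<rho> > 0" for \<rho>
  proof -
    have "m \<rho> / ennreal (\<rho> powr (n - b))
        \<le> ennreal (A * \<rho> powr n * R powr (- k)) / ennreal (\<rho> powr (n - b))"
      using m1[OF that] by (intro divide_right_mono_ennreal) (simp add: m_def n_def)
    also have "\<dots> = ennreal (A * \<rho> powr n * R powr (- k) / \<rho> powr (n - b))"
      using A that by (intro divide_ennreal) auto
    also have "A * \<rho> powr n * R powr (- k) / \<rho> powr (n - b) = A * R powr (- k) * \<rho> powr b"
      using that by (simp add: powr_diff)
    finally have "epowr (m \<rho> / ennreal (\<rho> powr (n - b))) e / ennreal \<rho>
        \<le> epowr (ennreal (A * R powr (- k) * \<rho> powr b)) e / ennreal \<rho>"
      using e by (intro divide_right_mono_ennreal epowr_mono) auto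
    also have "\<dots> = ennreal ((A * R powr (- k) * \<rho> powr b) powr e / \<rho>)"
      using A that by (simp add: epowr_ennreal divide_ennreal)
    also have "(A * R powr (- k) * \<rho> powr b) powr e / \<rho> = c1 * \<rho> powr (b * e - 1)"
      using A that by (simp add: c1_def powr_mult powr_powr powr_diff)
    finally show ?thesis .
  qed
  have far: "epowr (m \<rho> / ennreal (\<rho> powr (n - b))) e / ennreal \<rho> \<le> ennreal (c2 * \<rho> powr (- ((k - b) * e) - 1))"
    if "\<rho> > 0" for \<rho>
  proof -
    have "m \<rho> / ennreal (\<rho> powr (n - b))
        \<le> ennreal (A * \<rho> powr (n - k)) / ennreal (\<rho> powr (n - b))"
      using m2[OF that] by (intro divide_right_mono_ennreal) (simp add: m_def n_def)
    also have "\<dots> = ennreal (A * \<rho> powr (n - k) / \<rho> powr (n - b))"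
      using A that by (intro divide_ennreal) auto
    also have "A * \<rho> powr (n - k) / \<rho> powr (n - b) = A * \<rho> powr (- (k - b))"
      using that by (simp add: powr_diff)
    finally have "epowr (m \<rho> / ennreal (\<rho> powr (n - b))) e / ennreal \<rho>
        \<le> epowr (ennreal (A * \<rho> powr (- (k - b)))) e / ennreal \<rho>"
      using e by (intro divide_right_mono_ennreal epowr_mono) auto
    also have "\<dots> = ennreal ((A * \<rho> powr (- (k - b))) powr e / \<rho>)"
      using A that by (simp add: epowr_ennreal divide_ennreal)
    also have "(A * \<rho> powr (- (k - b))) powr e / \<rho> = c2 * \<rho> powr (- ((k - b) * e) - 1)"
    proof -
      have "(A * \<rho> powr (- (k - b))) powr e = c2 * \<rho> powr (- ((k - b) * e))"
        using A that by (simp add: c2_def powr_mult powr_powr del: minus_diff_eq)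
      then show ?thesis using that by (simp add: powr_diff)
    qed
    finally show ?thesis .
  qed
  have "((\<lambda>\<rho>. \<rho> powr (b * e - 1)) has_integral (R powr (b * e - 1 + 1) / (b * e - 1 + 1))) {0..R}"
    using be R by (intro has_integral_powr_from_0) auto
  from has_integral_mult_right[OF this, of c1]
  have I1: "(\<integral>\<^sup>+\<rho>. ennreal (c1 * \<rho> powr (b * e - 1)) * indicator {0..R} \<rho> \<partial>lborel)
      = ennreal (c1 * (R powr (b * e) / (b * e)))"
    by (subst nn_integral_has_integral_lebesgue') (auto simp: c1_def)
  have "((\<lambda>\<rho>. \<rho> powr (- ((k - b) * e) - 1)) has_integral
      - (R powr (- ((k - b) * e) - 1 + 1)) / (- ((k - b) * e) - 1 + 1)) {R..}"
    using be R by (intro has_integral_powr_to_inf) auto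
  then have "((\<lambda>\<rho>. \<rho> powr (- ((k - b) * e) - 1)) has_integral
      R powr (- ((k - b) * e)) / ((k - b) * e)) {R..}"
    by simp
  from has_integral_mult_right[OF this, of c2]
  have I2: "(\<integral>\<^sup>+\<rho>. ennreal (c2 * \<rho> powr (- ((k - b) * e) - 1)) * indicator {R..} \<rho> \<partial>lborel)
      = ennreal (c2 * (R powr (- ((k - b) * e)) / ((k - b) * e)))"
    by (subst nn_integral_has_integral_lebesgue') (auto simp: c2_def)
  have "wolff_potential u a q x
      = (\<integral>\<^sup>+\<rho>\<in>{0<..}. epowr (m \<rho> / ennreal (\<rho> powr (n - b))) e / ennreal \<rho> \<partial>lborel)"
    by (simp add: wolff_potential_def m_def n_def b_def e_def nn_integral_completion)
  also have "\<dots> \<le> (\<integral>\<^sup>+\<rho>. ennreal (c1 * \<rho> powr (b * e - 1)) * indicator {0..R} \<rho>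
        + ennreal (c2 * \<rho> powr (- ((k - b) * e) - 1)) * indicator {R..} \<rho> \<partial>lborel)"
  proof (intro nn_integral_mono)
    fix \<rho> :: real
    show "epowr (m \<rho> / ennreal (\<rho> powr (n - b))) e / ennreal \<rho> * indicator {0<..} \<rho>
      \<le> ennreal (c1 * \<rho> powr (b * e - 1)) * indicator {0..R} \<rho>
        + ennreal (c2 * \<rho> powr (- ((k - b) * e) - 1)) * indicator {R..} \<rho>"
      using near[of \<rho>] far[of \<rho>]
      by (cases "\<rho> > 0"; cases "\<rho> \<le> R"; cases "R \<le> \<rho>") (auto simp: add_increasing add_increasing2)
  qed
  also have "\<dots> = ennreal (c1 * (R powr (b * e) / (b * e)))
      + ennreal (c2 * (R powr (- ((k - b) * e)) / ((k - b) * e)))"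
    by (subst nn_integral_add) (simp_all add: I1 I2)
  also have "\<dots> = ennreal (c1 * (R powr (b * e) / (b * e)) + c2 * (R powr (- ((k - b) * e)) / ((k - b) * e)))"
    using be A by (intro ennreal_plus[symmetric]) (auto simp: c1_def c2_def)
  also have "c1 * (R powr (b * e) / (b * e)) + c2 * (R powr (- ((k - b) * e)) / ((k - b) * e))
      = A powr e * (1 / (b * e) + 1 / ((k - b) * e)) * R powr (- ((k - b) * e))"
  proof -
    have "c1 * R powr (b * e) = A powr e * (R powr (- (k * e)) * R powr (b * e))"
      using A R by (simp add: c1_def powr_mult powr_powr)
    also have "R powr (- (k * e)) * R powr (b * e) = R powr (- ((k - b) * e))"
      by (subst powr_add[symmetric]) (simp add: algebra_simps)
    finally show ?thesis by (simp add: c2_def distrib_left distrib_right)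
  qed
  finally show ?thesis using q by (simp add: e_def b_def)
qed

text \<open>
  Hedberg's argument with the exponents frozen at \<open>x\<close>. The bound on the density of \<open>G = |u|\<^bsup>r\<^esup>\<close>
  controls the mass of \<open>u\<close> on small balls, the total mass \<open>K\<close> of \<open>G\<close> the one on large balls. The
  optimal splitting radius is \<open>R = t\<^bsup>-q(x)/n\<^esup>\<close>, where \<open>q = n r (p - 1) / (n - \<alpha> p r)\<close> is just the
  exponent that makes the result linear in \<open>t\<close>. The constant does not depend on \<open>x\<close>, because \<open>p\<close> and \<open>r\<close>
  are bounded and \<open>p - 1\<close>, \<open>\<alpha>\<close> and \<open>n - \<alpha> p r\<close> are bounded away from \<open>0\<close>.
\<close>

lemma wolff_potential_le_of_modular_density:
  fixes \<Omega> :: "'a::euclidean_space set" and \<alpha> r p :: "'a \<Rightarrow> real" and u :: "'a \<Rightarrow> ereal"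
  assumes "bounded \<Omega>" and "log_holder_on \<Omega> r"
    and r: "\<And>x. x \<in> \<Omega> \<Longrightarrow> 1 \<le> r x" "\<And>x. x \<in> \<Omega> \<Longrightarrow> r x \<le> r1"
    and p: "1 < p0" "\<And>x. x \<in> \<Omega> \<Longrightarrow> p0 \<le> p x" "\<And>x. x \<in> \<Omega> \<Longrightarrow> p x \<le> p1"
    and \<alpha>: "0 < a0" "\<And>x. x \<in> \<Omega> \<Longrightarrow> a0 \<le> \<alpha> x"
    and gap: "0 < d0" "\<And>x. x \<in> \<Omega> \<Longrightarrow> d0 \<le> real DIM('a) - \<alpha> x * p x * r x"
    and u: "u \<in> borel_measurable lebesgue" "\<And>y. y \<notin> \<Omega> \<Longrightarrow> u y = 0"
    and G: "G \<in> borel_measurable lebesgue"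
      "\<And>y. y \<in> \<Omega> \<Longrightarrow> G y = epowr (e2ennreal \<bar>u y\<bar>) (r y)"
    and K: "1 \<le> K" "(\<integral>\<^sup>+y. G y \<partial>lebesgue) \<le> ennreal K"
  obtains c where "c > 0"
    and "\<And>x t. x \<in> \<Omega> \<Longrightarrow> 1 \<le> t \<Longrightarrow>
      (\<And>\<rho>. \<rho> > 0 \<Longrightarrow> (\<integral>\<^sup>+y\<in>ball x \<rho>. G y \<partial>lebesgue)
        \<le> ennreal (t powr (real DIM('a) * r x * (p x - 1) / (real DIM('a) - \<alpha> x * p x * r x))
                    * \<rho> powr real DIM('a))) \<Longrightarrow>
      wolff_potential u (\<alpha> x) (p x) x \<le> ennreal (c * t)"
proof -
  define n where "n = real DIM('a)"
  have n: "n > 0" by (simp add: n_def)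
  define F where "F y = e2ennreal \<bar>u y\<bar>" for y
  have F: "F \<in> borel_measurable lebesgue" "\<And>y. y \<notin> \<Omega> \<Longrightarrow> F y = 0"
    unfolding F_def using u by (auto simp: zero_ennreal.abs_eq)
  have GF: "\<And>y. y \<in> \<Omega> \<Longrightarrow> G y = epowr (F y) (r y)"
    using G(2) by (simp add: F_def)
  from log_holder_mass_bound[OF assms(2) r(1) K(1)]
  obtain A where A: "A > 0"
    and mass: "\<And>F G x \<rho> \<nu>. F \<in> borel_measurable lebesgue \<Longrightarrow> G \<in> borel_measurable lebesgue \<Longrightarrow>
           (\<And>y. y \<notin> \<Omega> \<Longrightarrow> F y = 0) \<Longrightarrow> (\<And>y. y \<in> \<Omega> \<Longrightarrow> G y = epowr (F y) (r y)) \<Longrightarrow>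
           x \<in> \<Omega> \<Longrightarrow> 0 < \<rho> \<Longrightarrow> 0 \<le> \<nu> \<Longrightarrow> \<nu> \<le> K \<Longrightarrow>
           (\<integral>\<^sup>+y\<in>ball x \<rho>. G y \<partial>lebesgue) \<le> ennreal \<nu> \<Longrightarrow>
           (\<integral>\<^sup>+y\<in>ball x \<rho>. F y \<partial>lebesgue)
             \<le> ennreal (A * \<rho> powr n * (1 + \<nu> / \<rho> powr n) powr (1 / r x))"
    unfolding n_def by blast
  have GK: "(\<integral>\<^sup>+y\<in>ball x \<rho>. G y \<partial>lebesgue) \<le> ennreal K" for x \<rho>
  proof -
    have "(\<integral>\<^sup>+y\<in>ball x \<rho>. G y \<partial>lebesgue) \<le> (\<integral>\<^sup>+y. G y \<partial>lebesgue)"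
      by (intro nn_integral_mono) (auto simp: indicator_def)
    then show ?thesis using K(2) by order
  qed
  from \<open>bounded \<Omega>\<close> obtain D0 where D0: "D0 > 0" "\<And>x. x \<in> \<Omega> \<Longrightarrow> norm x < D0"
    by (metis bounded_pos_less)
  define D where "D = 2 * D0 + 1"
  have D1: "D \<ge> 1" using D0 by (simp add: D_def)
  have inD: "dist x y < D" if "x \<in> \<Omega>" "y \<in> \<Omega>" for x y
    using D0(2)[OF that(1)] D0(2)[OF that(2)] norm_triangle_ineq4[of x y]
    by (simp add: D_def dist_norm)
  define B where "B = 2 * A + A * (D powr n + K) + 1"
  have DK: "D powr n + K \<ge> 1" using K by (simp add: add_increasing)
  have AD: "A * (D powr n + K) > 0" using A DK by simp
  then have B: "B \<ge> 1" "2 * A \<le> B" "A * (D powr n + K) \<le> B" using A by (auto simp: B_def)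

  have large: "(\<integral>\<^sup>+y\<in>ball x \<rho>. F y \<partial>lebesgue) \<le> ennreal (B * \<rho> powr (n - n / r x))"
    if x: "x \<in> \<Omega>" and \<rho>: "\<rho> > 0" for x \<rho>
  proof -
    have rx: "r x \<ge> 1" using r(1) x .
    have *: "(\<integral>\<^sup>+y\<in>ball x \<rho>. F y \<partial>lebesgue) \<le> ennreal (B * \<rho> powr (n - n / r x))"
      if \<rho>: "0 < \<rho>" "\<rho> \<le> D" for \<rho>
    proof -
      have "(\<integral>\<^sup>+y\<in>ball x \<rho>. F y \<partial>lebesgue)
          \<le> ennreal (A * \<rho> powr n * (1 + K / \<rho> powr n) powr (1 / r x))"
        using F G(1) GF K GK by (intro mass[where G = G] x \<rho>) auto
      also have "\<dots> \<le> ennreal (B * \<rho> powr (n - n / r x))"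
      proof (rule ennreal_leI)
        have "1 + K / \<rho> powr n = (\<rho> powr n + K) / \<rho> powr n"
          using \<rho> by (simp add: field_simps)
        then have "(1 + K / \<rho> powr n) powr (1 / r x) = (\<rho> powr n + K) powr (1 / r x) / \<rho> powr (n / r x)"
          using \<rho> K by (simp add: powr_divide powr_powr)
        then have "A * \<rho> powr n * (1 + K / \<rho> powr n) powr (1 / r x)
            = A * (\<rho> powr n + K) powr (1 / r x) * \<rho> powr (n - n / r x)"
          using \<rho> by (simp add: powr_diff)
        also have "\<dots> \<le> A * (D powr n + K) * \<rho> powr (n - n / r x)"
        proof (intro mult_right_mono mult_left_mono)
          have "(\<rho> powr n + K) powr (1 / r x) \<le> (\<rho> powr n + K) powr 1"
            using K rx by (intro powr_mono) (auto simp: add_increasing)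
          also have "\<dots> \<le> D powr n + K"
            using \<rho> n K by (simp add: powr_mono2)
          finally show "(\<rho> powr n + K) powr (1 / r x) \<le> D powr n + K" .
        qed (use A in auto)
        also have "\<dots> \<le> B * \<rho> powr (n - n / r x)"
          using B by (intro mult_right_mono) auto
        finally show "A * \<rho> powr n * (1 + K / \<rho> powr n) powr (1 / r x) \<le> B * \<rho> powr (n - n / r x)" .
      qed
      finally show ?thesis .
    qed
    show ?thesis
    proof (cases "\<rho> \<le> D")
      case True
      then show ?thesis using * \<rho> by blast
    next
      case False
      \<comment> \<open>\<open>u\<close> has no mass outside the ball of radius \<open>D\<close>\<close>
      have "(\<integral>\<^sup>+y\<in>ball x \<rho>. F y \<partial>lebesgue) \<le> (\<integral>\<^sup>+y\<in>ball x D. F y \<partial>lebesgue)"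
        using F(2) inD[OF x] by (intro nn_integral_mono) (auto simp: indicator_def)
      also have "\<dots> \<le> ennreal (B * D powr (n - n / r x))"
        using *[of D] D1 by simp
      also have "\<dots> \<le> ennreal (B * \<rho> powr (n - n / r x))"
      proof (intro ennreal_leI mult_left_mono powr_mono2)
        show "0 \<le> n - n / r x" using n rx by (simp add: field_simps)
      qed (use False D1 B in auto)
      finally show ?thesis .
    qed
  qed

  define c where "c = B powr (1 / (p0 - 1)) * (1 / a0 + \<bar>p1\<bar> * \<bar>r1\<bar> / d0)"
  have c: "c > 0"
    unfolding c_def using B \<alpha> gap by (intro mult_pos_pos add_pos_nonneg) auto
  show thesis
  proof (rule that[OF c])
    fix x t
    assume x: "x \<in> \<Omega>" and t: "1 \<le> (t::real)"
      and dens: "\<And>\<rho>. \<rho> > 0 \<Longrightarrow> (\<integral>\<^sup>+y\<in>ball x \<rho>. G y \<partial>lebesgue)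
        \<le> ennreal (t powr (real DIM('a) * r x * (p x - 1) / (real DIM('a) - \<alpha> x * p x * r x))
                    * \<rho> powr real DIM('a))"
    define q where "q = n * r x * (p x - 1) / (n - \<alpha> x * p x * r x)"
    have rx: "1 \<le> r x" "r x \<le> r1" and px: "p0 \<le> p x" "p x \<le> p1" "1 < p x"
      and ax: "a0 \<le> \<alpha> x" "0 < \<alpha> x" and gx: "d0 \<le> n - \<alpha> x * p x * r x" "0 < n - \<alpha> x * p x * r x"
      using r[OF x] p(2,3)[OF x] p(1) \<alpha>(2)[OF x] \<alpha>(1) gap(2)[OF x] gap(1) by (auto simp: n_def)
    have q: "q \<ge> 0" unfolding q_def using n rx px gx by (intro divide_nonneg_pos mult_nonneg_nonneg) auto
    define s where "s = t powr q"
    have s: "s \<ge> 1" unfolding s_def using t q by (intro ge_one_powr_ge_zero) auto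
    define R where "R = s powr (- (1 / n))"
    have R: "R > 0" using s by (simp add: R_def)
    define k where "k = n / r x"
    have k_diff: "k - \<alpha> x * p x = (n - \<alpha> x * p x * r x) / r x"
      using rx by (simp add: k_def field_simps)
    have k: "0 < \<alpha> x * p x" "\<alpha> x * p x < k"
    proof -
      show "0 < \<alpha> x * p x" using ax px by simp
      have "0 < (n - \<alpha> x * p x * r x) / r x" using gx rx by simp
      then show "\<alpha> x * p x < k" using k_diff by linarith
    qed
    have small: "(\<integral>\<^sup>+y\<in>ball x \<rho>. F y \<partial>lebesgue) \<le> ennreal (B * \<rho> powr n * R powr (- k))"
      if \<rho>: "\<rho> > 0" for \<rho>
    proof -
      \<comment> \<open>the cap by \<open>K\<close> keeps \<open>1 + \<nu> / \<rho>\<^bsup>n\<^esup>\<close> polynomial in \<open>1/\<rho>\<close> however large \<open>s\<close> is\<close>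
      define \<nu> where "\<nu> = min K (s * \<rho> powr n)"
      have \<nu>: "0 \<le> \<nu>" "\<nu> \<le> K" "\<nu> \<le> s * \<rho> powr n" using K s by (auto simp: \<nu>_def)
      have "(\<integral>\<^sup>+y\<in>ball x \<rho>. G y \<partial>lebesgue) \<le> ennreal (s * \<rho> powr n)"
        using dens[OF \<rho>] by (simp add: s_def q_def n_def)
      then have "(\<integral>\<^sup>+y\<in>ball x \<rho>. G y \<partial>lebesgue) \<le> ennreal \<nu>"
        using GK by (simp add: \<nu>_def min_def)
      then have "(\<integral>\<^sup>+y\<in>ball x \<rho>. F y \<partial>lebesgue)
          \<le> ennreal (A * \<rho> powr n * (1 + \<nu> / \<rho> powr n) powr (1 / r x))"
        using F G(1) GF \<nu> by (intro mass[where G = G] x \<rho>) auto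
      also have "\<dots> \<le> ennreal (B * \<rho> powr n * R powr (- k))"
      proof (rule ennreal_leI)
        have "\<nu> / \<rho> powr n \<le> s" using \<nu>(3) \<rho> by (simp add: field_simps)
        then have "1 + \<nu> / \<rho> powr n \<le> 2 * s" using s by simp
        then have "(1 + \<nu> / \<rho> powr n) powr (1 / r x) \<le> (2 * s) powr (1 / r x)"
          using rx \<nu> by (intro powr_mono2) auto
        also have "\<dots> = 2 powr (1 / r x) * s powr (1 / r x)"
          using s by (simp add: powr_mult)
        also have "\<dots> \<le> 2 powr 1 * s powr (1 / r x)"
          using rx by (intro mult_right_mono powr_mono) auto
        also have "s powr (1 / r x) = R powr (- k)"
          using s n rx by (simp add: R_def k_def powr_powr)
        finally have "A * \<rho> powr n * (1 + \<nu> / \<rho> powr n) powr (1 / r x) \<le> A * \<rho> powr n * (2 * R powr (- k))"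
          using A by (intro mult_left_mono) auto
        also have "\<dots> = (2 * A) * (\<rho> powr n * R powr (- k))" by simp
        also have "\<dots> \<le> B * (\<rho> powr n * R powr (- k))"
          using B by (intro mult_right_mono) auto
        finally show "A * \<rho> powr n * (1 + \<nu> / \<rho> powr n) powr (1 / r x) \<le> B * \<rho> powr n * R powr (- k)"
          by simp
      qed
      finally show ?thesis .
    qed
    have "wolff_potential u (\<alpha> x) (p x) x
      \<le> ennreal (B powr (1 / (p x - 1)) * ((p x - 1) / (\<alpha> x * p x) + (p x - 1) / (k - \<alpha> x * p x))
                  * R powr (- ((k - \<alpha> x * p x) / (p x - 1))))"
      using large[OF x] small B R px k
      by (intro wolff_potential_le_of_mass_bounds) (auto simp: F_def n_def k_def)
    also have "R powr (- ((k - \<alpha> x * p x) / (p x - 1))) = t"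
    proof -
      have "R powr (- ((k - \<alpha> x * p x) / (p x - 1))) = t powr (q * ((k - \<alpha> x * p x) / (p x - 1)) / n)"
        by (simp add: R_def s_def powr_powr mult.commute)
      also have "q * ((k - \<alpha> x * p x) / (p x - 1)) / n = 1"
        unfolding k_diff q_def using n rx px gx by simp
      finally show ?thesis using t by simp
    qed
    also have "ennreal (B powr (1 / (p x - 1)) * ((p x - 1) / (\<alpha> x * p x) + (p x - 1) / (k - \<alpha> x * p x)) * t)
        \<le> ennreal (c * t)"
    proof (intro ennreal_leI mult_right_mono)
      have "(p x - 1) / (\<alpha> x * p x) \<le> p x / (\<alpha> x * p x)"
        using ax px by (intro divide_right_mono) auto
      also have "\<dots> = 1 / \<alpha> x" using px by simp
      also have "\<dots> \<le> 1 / a0" using ax \<alpha>(1) by (intro divide_left_mono) auto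
      finally have e1: "(p x - 1) / (\<alpha> x * p x) \<le> 1 / a0" .
      have "(p x - 1) / (k - \<alpha> x * p x) = (p x - 1) * r x / (n - \<alpha> x * p x * r x)"
        unfolding k_diff by simp
      also have "\<dots> \<le> \<bar>p1\<bar> * \<bar>r1\<bar> / d0"
        using gx gap(1) rx px by (intro frac_le mult_mono) auto
      finally have e2: "(p x - 1) / (k - \<alpha> x * p x) \<le> \<bar>p1\<bar> * \<bar>r1\<bar> / d0" .
      have e3: "B powr (1 / (p x - 1)) \<le> B powr (1 / (p0 - 1))"
        using B px p(1) by (intro powr_mono divide_left_mono) auto
      show "B powr (1 / (p x - 1)) * ((p x - 1) / (\<alpha> x * p x) + (p x - 1) / (k - \<alpha> x * p x)) \<le> c"
        unfolding c_def using e1 e2 e3 k px by (intro mult_mono add_mono) auto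
    qed (use t in simp)
    finally show "wolff_potential u (\<alpha> x) (p x) x \<le> ennreal (c * t)" .
  qed
qed

section \<open>A weak-type inequality with variable exponent\<close>

lemma nn_integral_disjoint_family_le:
  assumes "countable I" and "\<And>i. i \<in> I \<Longrightarrow> X i \<in> sets M"
    and "pairwise (\<lambda>i j. disjnt (X i) (X j)) I" and [measurable]: "G \<in> borel_measurable M"
  shows "(\<integral>\<^sup>+i. (\<integral>\<^sup>+y\<in>X i. G y \<partial>M) \<partial>count_space I) \<le> (\<integral>\<^sup>+y. G y \<partial>M)"
proof -
  have "(\<integral>\<^sup>+i. (\<integral>\<^sup>+y\<in>X i. G y \<partial>M) \<partial>count_space I)
      = (\<integral>\<^sup>+y. (\<integral>\<^sup>+i. G y * indicator (X i) y \<partial>count_space I) \<partial>M)"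
    using assms(1,2) by (intro nn_integral_count_space_nn_integral[symmetric]) auto
  also have "\<dots> \<le> (\<integral>\<^sup>+y. G y \<partial>M)"
  proof (intro nn_integral_mono)
    fix y
    show "(\<integral>\<^sup>+i. G y * indicator (X i) y \<partial>count_space I) \<le> G y"
    proof (cases "\<exists>i\<in>I. y \<in> X i")
      case True
      then obtain i where i: "i \<in> I" "y \<in> X i" by blast
      have "(\<integral>\<^sup>+j. G y * indicator (X j) y \<partial>count_space I)
          = (\<integral>\<^sup>+j. G y * indicator {i} j \<partial>count_space I)"
        using i assms(3) by (intro nn_integral_cong) (auto simp: indicator_def pairwise_def disjnt_def)
      also have "\<dots> = G y" using i by (simp add: nn_integral_cmult_indicator)
      finally show ?thesis by simp
    next
      case False
      then have "(\<integral>\<^sup>+i. G y * indicator (X i) y \<partial>count_space I) = (\<integral>\<^sup>+i. 0 \<partial>count_space I)"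
        by (intro nn_integral_cong) (auto simp: indicator_def)
      then show ?thesis by simp
    qed
  qed
  finally show ?thesis .
qed

text \<open>
  The weak-type inequality of the maximal function, with a threshold \<open>t\<^bsup>q(x)\<^esup>\<close> that depends on the
  point. The Vitali covering argument goes through because a ball of radius \<open>\<rho>\<close> on which the
  threshold is exceeded satisfies \<open>t\<^bsup>q(x)\<^esup> \<le> K / \<rho>\<^bsup>n\<^esup>\<close>, so that \<open>t\<close> is at most polynomial in
  \<open>1/\<rho>\<close> and \<open>t\<^bsup>q\<^esup>\<close> is constant on the enlarged ball up to a factor.
\<close>

lemma variable_exponent_weak_type:
  fixes q :: "'a::euclidean_space \<Rightarrow> real"
  assumes "log_holder_on \<Omega> q" and q0: "0 < q0" "\<And>x. x \<in> \<Omega> \<Longrightarrow> q0 \<le> q x" and K: "1 \<le> K"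
  obtains C where "C > 0"
    and "\<And>G E t. G \<in> borel_measurable lebesgue \<Longrightarrow> (\<integral>\<^sup>+y. G y \<partial>lebesgue) \<le> ennreal K \<Longrightarrow>
      E \<subseteq> \<Omega> \<Longrightarrow> 1 \<le> t \<Longrightarrow>
      (\<And>x. x \<in> E \<Longrightarrow> \<exists>\<rho>>0. ennreal (t powr q x * \<rho> powr real DIM('a))
                            \<le> (\<integral>\<^sup>+y\<in>ball x \<rho>. G y \<partial>lebesgue)) \<Longrightarrow>
      (\<integral>\<^sup>+x\<in>E. ennreal (t powr q x) \<partial>lebesgue) \<le> ennreal C"
proof -
  define n where "n = real DIM('a)"
  have n: "n > 0" by (simp add: n_def)
  define M where "M = (K * 5 powr n) powr (1 / q0)"
  have "1 * 1 \<le> K * 5 powr n"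
    using K n by (intro mult_mono ge_one_powr_ge_zero) auto
  then have M: "M \<ge> 1" unfolding M_def using q0 by (intro ge_one_powr_ge_zero) auto
  have N: "n / q0 \<ge> 0" using n q0 by simp
  from log_holder_powr_comparable[OF assms(1) M N]
  obtain C where C: "C \<ge> 1"
    and cmp: "\<And>x y \<rho> T. x \<in> \<Omega> \<Longrightarrow> y \<in> \<Omega> \<Longrightarrow> dist x y \<le> \<rho> \<Longrightarrow> 0 < \<rho> \<Longrightarrow> 1 \<le> T \<Longrightarrow>
           T \<le> M * (exp 1 + 1 / \<rho>) powr (n / q0) \<Longrightarrow> T powr q x \<le> C * T powr q y"
    by blast
  define V where "V = measure lebesgue (ball (0::'a) 1)"
  have V: "V > 0" by (simp add: V_def content_ball_pos)
  define C' where "C' = C * 5 powr n * V"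
  have C': "C' > 0" using C V by (simp add: C'_def)
  show thesis
  proof (rule that[of "C' * K"])
    show "C' * K > 0" using C' K by simp
    fix G :: "'a \<Rightarrow> ennreal" and E and t :: real
    assume G[measurable]: "G \<in> borel_measurable lebesgue" and GK: "(\<integral>\<^sup>+y. G y \<partial>lebesgue) \<le> ennreal K"
      and E: "E \<subseteq> \<Omega>" and t: "1 \<le> t"
      and "\<And>x. x \<in> E \<Longrightarrow> \<exists>\<rho>>0. ennreal (t powr q x * \<rho> powr real DIM('a))
                            \<le> (\<integral>\<^sup>+y\<in>ball x \<rho>. G y \<partial>lebesgue)"
    then obtain \<rho> where \<rho>: "\<And>x. x \<in> E \<Longrightarrow> \<rho> x > 0"
      and dens: "\<And>x. x \<in> E \<Longrightarrow> ennreal (t powr q x * \<rho> x powr n) \<le> (\<integral>\<^sup>+y\<in>ball x (\<rho> x). G y \<partial>lebesgue)"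
      unfolding n_def by metis
    have upper: "t powr q x * \<rho> x powr n \<le> K" if x: "x \<in> E" for x
    proof -
      have "(\<integral>\<^sup>+y\<in>ball x (\<rho> x). G y \<partial>lebesgue) \<le> (\<integral>\<^sup>+y. G y \<partial>lebesgue)"
        by (intro nn_integral_mono) (auto simp: indicator_def)
      with dens[OF x] GK have "ennreal (t powr q x * \<rho> x powr n) \<le> ennreal K" by order
      then show ?thesis using K by (simp add: ennreal_le_iff)
    qed
    have rad: "0 < \<rho> x \<and> \<rho> x \<le> K powr (1 / n)" if x: "x \<in> E" for x
    proof -
      have "1 \<le> t powr q x"
        using t q0(1) q0(2)[of x] x E by (intro ge_one_powr_ge_zero) auto
      then have "1 * \<rho> x powr n \<le> t powr q x * \<rho> x powr n"
        by (intro mult_right_mono) auto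
      also have "\<dots> \<le> K" by (rule upper[OF x])
      finally have "(\<rho> x powr n) powr (1 / n) \<le> K powr (1 / n)"
        using n by (intro powr_mono2) auto
      then show ?thesis using n \<rho>[OF x] by (simp add: powr_powr)
    qed
    have tM: "t \<le> M * (exp 1 + 1 / (5 * \<rho> x)) powr (n / q0)" if x: "x \<in> E" for x
    proof -
      have px: "\<rho> x > 0" using \<rho> x .
      have "t powr q0 * \<rho> x powr n \<le> t powr q x * \<rho> x powr n"
        using t q0(2)[of x] x E by (intro mult_right_mono powr_mono) auto
      also have "\<dots> \<le> K" by (rule upper[OF x])
      finally have "t powr q0 \<le> K / \<rho> x powr n"
        using px by (simp add: field_simps)
      also have "\<dots> = K * 5 powr n * (1 / (5 * \<rho> x)) powr n"
        using px by (simp add: powr_divide powr_mult)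
      finally have "(t powr q0) powr (1 / q0) \<le> (K * 5 powr n * (1 / (5 * \<rho> x)) powr n) powr (1 / q0)"
        using q0 by (intro powr_mono2) auto
      also have "(t powr q0) powr (1 / q0) = t" using t q0 by (simp add: powr_powr)
      also have "(K * 5 powr n * (1 / (5 * \<rho> x)) powr n) powr (1 / q0)
          = M * (1 / (5 * \<rho> x)) powr (n / q0)"
        using K px unfolding M_def by (subst powr_mult) (auto simp: powr_powr)
      also have "\<dots> \<le> M * (exp 1 + 1 / (5 * \<rho> x)) powr (n / q0)"
        using M N px by (intro mult_left_mono powr_mono2) auto
      finally show ?thesis .
    qed
    have "E \<subseteq> (\<Union>x\<in>E. ball x (\<rho> x))" using \<rho> by force
    then obtain I where I: "countable I" "I \<subseteq> E"
        "pairwise (\<lambda>i j. disjnt (ball i (\<rho> i)) (ball j (\<rho> j))) I"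
        "E \<subseteq> (\<Union>i\<in>I. ball i (5 * \<rho> i))"
      by (rule Vitali_covering_lemma_balls[OF _ rad]) auto
    have "(\<integral>\<^sup>+x\<in>E. ennreal (t powr q x) \<partial>lebesgue)
        \<le> (\<integral>\<^sup>+x. (\<integral>\<^sup>+i. ennreal (C * t powr q i) * indicator (ball i (5 * \<rho> i)) x \<partial>count_space I) \<partial>lebesgue)"
    proof (intro nn_integral_mono)
      fix x
      show "ennreal (t powr q x) * indicator E x
          \<le> (\<integral>\<^sup>+i. ennreal (C * t powr q i) * indicator (ball i (5 * \<rho> i)) x \<partial>count_space I)"
      proof (cases "x \<in> E")
        case True
        then obtain j where j: "j \<in> I" "x \<in> ball j (5 * \<rho> j)" using I(4) by blast
        have jE: "j \<in> E" using j I(2) by blast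
        have "t powr q x \<le> C * t powr q j"
          using True jE E j(2) \<rho>[OF jE] t tM[OF jE]
          by (intro cmp[of x j "5 * \<rho> j"]) (auto simp: dist_commute)
        then have "ennreal (t powr q x) * indicator E x
            \<le> ennreal (C * t powr q j) * indicator (ball j (5 * \<rho> j)) x"
          using True j(2) by (simp add: ennreal_leI)
        also have "\<dots> \<le> (\<integral>\<^sup>+i. ennreal (C * t powr q i) * indicator (ball i (5 * \<rho> i)) x \<partial>count_space I)"
          using j(1) by (rule nn_integral_ge_point)
        finally show ?thesis .
      qed simp
    qed
    also have "\<dots> = (\<integral>\<^sup>+i. (\<integral>\<^sup>+x. ennreal (C * t powr q i) * indicator (ball i (5 * \<rho> i)) x \<partial>lebesgue) \<partial>count_space I)"
      by (intro nn_integral_count_space_nn_integral I borel_measurable_times_ennreal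
            borel_measurable_const borel_measurable_indicator) simp
    also have "\<dots> \<le> (\<integral>\<^sup>+i. ennreal C' * (\<integral>\<^sup>+y\<in>ball i (\<rho> i). G y \<partial>lebesgue) \<partial>count_space I)"
    proof (intro nn_integral_mono)
      fix i assume "i \<in> space (count_space I)"
      then have i: "i \<in> E" using I(2) by auto
      then have \<rho>i: "\<rho> i > 0" by (rule \<rho>)
      have "(\<integral>\<^sup>+x. ennreal (C * t powr q i) * indicator (ball i (5 * \<rho> i)) x \<partial>lebesgue)
          = ennreal (C * t powr q i) * ennreal ((5 * \<rho> i) powr n * V)"
        using emeasure_lebesgue_ball[of "5 * \<rho> i" i] \<rho>i
        by (subst nn_integral_cmult_indicator) (auto simp: V_def n_def)
      also have "\<dots> = ennreal ((C * t powr q i) * ((5 * \<rho> i) powr n * V))"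
        using C V by (simp add: ennreal_mult)
      also have "(C * t powr q i) * ((5 * \<rho> i) powr n * V) = C' * (t powr q i * \<rho> i powr n)"
        using \<rho>i by (simp add: C'_def powr_mult)
      also have "ennreal \<dots> = ennreal C' * ennreal (t powr q i * \<rho> i powr n)"
        using C' by (simp add: ennreal_mult)
      also have "\<dots> \<le> ennreal C' * (\<integral>\<^sup>+y\<in>ball i (\<rho> i). G y \<partial>lebesgue)"
        using dens[OF i] by (intro mult_left_mono) auto
      finally show "(\<integral>\<^sup>+x. ennreal (C * t powr q i) * indicator (ball i (5 * \<rho> i)) x \<partial>lebesgue)
          \<le> ennreal C' * (\<integral>\<^sup>+y\<in>ball i (\<rho> i). G y \<partial>lebesgue)" .
    qed
    also have "\<dots> = ennreal C' * (\<integral>\<^sup>+i. (\<integral>\<^sup>+y\<in>ball i (\<rho> i). G y \<partial>lebesgue) \<partial>count_space I)"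
      by (intro nn_integral_cmult) auto
    also have "\<dots> \<le> ennreal C' * (\<integral>\<^sup>+y. G y \<partial>lebesgue)"
      using I by (intro mult_left_mono nn_integral_disjoint_family_le) auto
    also have "\<dots> \<le> ennreal C' * ennreal K"
      using GK by (intro mult_left_mono) auto
    also have "\<dots> = ennreal (C' * K)" using C' K by (simp add: ennreal_mult)
    finally show "(\<integral>\<^sup>+x\<in>E. ennreal (t powr q x) \<partial>lebesgue) \<le> ennreal (C' * K)" .
  qed
qed

section \<open>Measurability of the potential\<close>

lemma borel_measurable_indicator_times_continuous:
  fixes g :: "'a::euclidean_space \<Rightarrow> real"
  assumes "open \<Omega>" and "continuous_on \<Omega> g"
  shows "(\<lambda>x. indicator \<Omega> x * g x) \<in> borel_measurable borel"
  using borel_measurable_continuous_on_indicator[OF _ assms(2)] assms(1)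
  by (simp add: borel_open)

text \<open>
  Replacing \<open>|u|\<close> by a Borel function that agrees with it almost everywhere leaves every ball
  integral unchanged and makes the integrands jointly Borel measurable in the centre, the radius and
  the integration variable, so that Tonelli's theorem applies.
\<close>

lemma borel_measurable_wolff_potential:
  fixes \<Omega> :: "'a::euclidean_space set" and u :: "'a \<Rightarrow> ereal"
  assumes "open \<Omega>" and "continuous_on \<Omega> \<alpha>" and "continuous_on \<Omega> p"
    and [measurable]: "u \<in> borel_measurable lebesgue"
  shows "(\<lambda>x. wolff_potential u (\<alpha> x) (p x) x) \<in> borel_measurable (lebesgue_on \<Omega>)"
proof -
  have "(\<lambda>y. e2ennreal \<bar>u y\<bar>) \<in> borel_measurable (completion lborel)" by measurable
  from completion_ex_borel_measurable[OF this] obtain U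
    where U[measurable]: "U \<in> borel_measurable lborel"
      and ae: "AE y in lborel. e2ennreal \<bar>u y\<bar> = U y"
    by blast
  have mass: "(\<integral>\<^sup>+y\<in>ball x \<rho>. e2ennreal \<bar>u y\<bar> \<partial>lebesgue)
      = (\<integral>\<^sup>+y. U y * (if dist x y < \<rho> then 1 else 0) \<partial>lborel)" for x \<rho>
    unfolding nn_integral_completion using ae
    by (intro nn_integral_cong_AE) (auto simp: indicator_def)
  define \<alpha>' where "\<alpha>' x = indicator \<Omega> x * \<alpha> x" for x
  define p' where "p' x = indicator \<Omega> x * p x" for x
  have [measurable]: "\<alpha>' \<in> borel_measurable borel" "p' \<in> borel_measurable borel"
    unfolding \<alpha>'_def p'_def using assms by (intro borel_measurable_indicator_times_continuous; simp)+
  define W where "W x = (\<integral>\<^sup>+\<rho>. epowr ((\<integral>\<^sup>+y. U y * (if dist x y < \<rho> then 1 else 0) \<partial>lborel)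
      / ennreal (\<rho> powr (real DIM('a) - \<alpha>' x * p' x))) (1 / (p' x - 1))
      / ennreal \<rho> * indicator {0<..} \<rho> \<partial>lborel)" for x
  have "W \<in> borel_measurable borel"
    unfolding W_def by measurable
  then have "W \<in> borel_measurable lebesgue"
    by (intro measurable_completion) simp
  then have "W \<in> borel_measurable (lebesgue_on \<Omega>)"
    by (rule measurable_restrict_space1)
  moreover have "wolff_potential u (\<alpha> x) (p x) x = W x" if "x \<in> \<Omega>" for x
    unfolding wolff_potential_def W_def mass
    using that by (simp add: \<alpha>'_def p'_def nn_integral_completion)
  ultimately show ?thesis
    by (subst measurable_cong[where g = W]) auto
qed

section \<open>The weak-type estimate of the Wolff potential\<close>

text \<open>
  Any uniform bound \<open>T\<close> of the modulars is as good as the bound \<open>1\<close> that the Luxemburg norm asks for: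
  since \<open>q \<ge> q\<^sub>0 > 0\<close>, enlarging \<open>c\<close> by the factor \<open>T\<^bsup>1/q\<^sub>0\<^esup>\<close> divides the modular by at least \<open>T\<close>.
\<close>

lemma weak_var_Lebesgue_memI:
  fixes \<Omega> :: "'a::euclidean_space set"
  assumes \<Omega>: "\<Omega> \<in> sets lebesgue" and f: "f \<in> borel_measurable (lebesgue_on \<Omega>)"
    and q_meas: "q \<in> borel_measurable (lebesgue_on \<Omega>)"
    and q: "0 < q0" "\<And>x. x \<in> \<Omega> \<Longrightarrow> q0 \<le> q x" and c: "0 < c" and T: "1 \<le> T"
    and le: "\<And>l. l > 0 \<Longrightarrow>
      (\<integral>\<^sup>+x\<in>{x \<in> \<Omega>. ereal l < \<bar>f x\<bar>}. ennreal ((l / c) powr q x) \<partial>lebesgue) \<le> ennreal T"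
  shows "f \<in> weak_var_Lebesgue \<Omega> q"
proof -
  define \<Lambda> where "\<Lambda> = c * T powr (1 / q0)"
  have \<Lambda>: "\<Lambda> > 0" using c T by (simp add: \<Lambda>_def)
  note [measurable] = f q_meas
  have "ennreal l * luxemburg_norm \<Omega> q (indicator {x \<in> \<Omega>. \<bar>f x\<bar> > ereal l}) \<le> ennreal \<Lambda>"
    if l: "l > 0" for l
  proof -
    define E where "E = {x \<in> \<Omega>. \<bar>f x\<bar> > ereal l}"
    have "E = {x \<in> space (lebesgue_on \<Omega>). ereal l < \<bar>f x\<bar>}"
      using \<Omega> by (auto simp: E_def)
    also have "\<dots> \<in> sets (lebesgue_on \<Omega>)" by measurable
    finally have E_meas[measurable]: "E \<in> sets (lebesgue_on \<Omega>)" .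
    have "var_modular \<Omega> q (\<lambda>x. indicator E x / ereal (\<Lambda> / l))
        = (\<integral>\<^sup>+x. epowr (e2ennreal \<bar>indicator E x / ereal (\<Lambda> / l)\<bar>) (q x) \<partial>lebesgue_on \<Omega>)"
      by (simp add: var_modular_def)
    also have "\<dots> \<le> (\<integral>\<^sup>+x. ennreal (1 / T) * (ennreal ((l / c) powr q x) * indicator E x) \<partial>lebesgue_on \<Omega>)"
    proof (intro nn_integral_mono)
      fix x
      show "epowr (e2ennreal \<bar>indicator E x / ereal (\<Lambda> / l)\<bar>) (q x)
          \<le> ennreal (1 / T) * (ennreal ((l / c) powr q x) * indicator E x)"
      proof (cases "x \<in> E")
        case True
        then have x: "x \<in> \<Omega>" by (simp add: E_def)
        have "\<bar>indicator E x / ereal (\<Lambda> / l)\<bar> = ereal (l / \<Lambda>)"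
          using True l \<Lambda> by (simp add: one_ereal_def)
        then have "epowr (e2ennreal \<bar>indicator E x / ereal (\<Lambda> / l)\<bar>) (q x) = ennreal ((l / \<Lambda>) powr q x)"
          using l \<Lambda> by (simp add: epowr_ennreal flip: ennreal.abs_eq)
        also have "\<dots> \<le> ennreal (1 / T * (l / c) powr q x)"
        proof (rule ennreal_leI)
          have "T powr 1 \<le> T powr (q x / q0)"
            using T q(1) q(2)[OF x] by (intro powr_mono) auto
          then have *: "T \<le> T powr (q x / q0)" using T by simp
          have "(l / \<Lambda>) powr q x = (l / c) powr q x / T powr (q x / q0)"
            using l c T q by (simp add: \<Lambda>_def powr_divide powr_mult powr_powr)
          also have "\<dots> \<le> (l / c) powr q x / T"
            using * T by (intro divide_left_mono) auto
          finally show "(l / \<Lambda>) powr q x \<le> 1 / T * (l / c) powr q x" by simp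
        qed
        also have "\<dots> = ennreal (1 / T) * ennreal ((l / c) powr q x)"
          using T by (intro ennreal_mult) auto
        finally show ?thesis using True by simp
      qed (simp add: epowr_def zero_ennreal.abs_eq[symmetric])
    qed
    also have "\<dots> = ennreal (1 / T) * (\<integral>\<^sup>+x\<in>E. ennreal ((l / c) powr q x) \<partial>lebesgue_on \<Omega>)"
      using E_meas by (intro nn_integral_cmult) measurable
    also have "(\<integral>\<^sup>+x\<in>E. ennreal ((l / c) powr q x) \<partial>lebesgue_on \<Omega>)
        = (\<integral>\<^sup>+x\<in>E. ennreal ((l / c) powr q x) \<partial>lebesgue)"
      using \<Omega> by (subst nn_integral_restrict_space)
        (auto simp: E_def indicator_def intro!: nn_integral_cong)
    also have "ennreal (1 / T) * (\<integral>\<^sup>+x\<in>E. ennreal ((l / c) powr q x) \<partial>lebesgue)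
        \<le> ennreal (1 / T) * ennreal T"
      using le[OF l] unfolding E_def by (intro mult_left_mono) auto
    also have "\<dots> = 1" using T by (simp flip: ennreal_mult)
    finally have "luxemburg_norm \<Omega> q (indicator E) \<le> ennreal (\<Lambda> / l)"
      unfolding luxemburg_norm_def using l \<Lambda> by (intro Inf_lower) auto
    then have "ennreal l * luxemburg_norm \<Omega> q (indicator E) \<le> ennreal l * ennreal (\<Lambda> / l)"
      by (intro mult_left_mono) auto
    also have "\<dots> = ennreal \<Lambda>" using l \<Lambda> by (simp flip: ennreal_mult)
    finally show ?thesis by (simp add: E_def)
  qed
  then have "(SUP l\<in>{0<..}. ennreal l * luxemburg_norm \<Omega> q (indicator {x \<in> \<Omega>. \<bar>f x\<bar> > ereal l}))
      \<le> ennreal \<Lambda>"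
    by (intro SUP_least) auto
  also have "\<dots> < \<infinity>" by simp
  finally show ?thesis using f by (simp add: weak_var_Lebesgue_def)
qed

theorem theorem7p2:
  fixes \<Omega> :: "'a::euclidean_space set"
    and \<alpha> r p :: "'a \<Rightarrow> real"
    and f :: "'a \<Rightarrow> ereal"
  assumes "open \<Omega>" and "bounded \<Omega>"
    and "bounded (\<alpha> ` \<Omega>)" and "bounded (r ` \<Omega>)" and "bounded (p ` \<Omega>)"
    and "log_holder_on \<Omega> \<alpha>" and "log_holder_on \<Omega> r" and "log_holder_on \<Omega> p"
    and "ess_inf_on \<Omega> p > 1"
    and "ess_inf_on \<Omega> r \<ge> 1"
    and "0 < ess_inf_on \<Omega> \<alpha>"
    and "ess_sup_on \<Omega> \<alpha> < ereal (real DIM('a))"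
    and "ess_sup_on \<Omega> (\<lambda>x. \<alpha> x * p x * r x) < ereal (real DIM('a))"
    and "\<And>x. x \<in> \<Omega> \<Longrightarrow> p x \<ge> 1 + 1 / r x - \<alpha> x / real DIM('a)"
    and "f \<in> var_Lebesgue \<Omega> r"
  shows "(\<lambda>x. enn2ereal (wolff_potential (zero_extend \<Omega> f) (\<alpha> x) (p x) x))
    \<in> weak_var_Lebesgue \<Omega> (\<lambda>x. real DIM('a) * r x * (p x - 1) / (real DIM('a) - \<alpha> x * p x * r x))"
proof -
  define n where "n = real DIM('a)"
  have n: "n > 0" by (simp add: n_def)
  define q where "q x = n * r x * (p x - 1) / (n - \<alpha> x * p x * r x)" for x
  note \<Omega> = \<open>open \<Omega>\<close>
  have \<Omega>_sets: "\<Omega> \<in> sets lebesgue" using \<Omega> by simp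

  have cont: "continuous_on \<Omega> \<alpha>" "continuous_on \<Omega> r" "continuous_on \<Omega> p"
    using assms(6-8) by (auto intro: log_holder_on_imp_continuous_on)
  from assms(9) obtain p0 where p0: "1 < p0" "ereal p0 < ess_inf_on \<Omega> p"
    unfolding one_ereal_def by (metis ereal_dense2 ereal_less_eq(3) less_ereal.simps(1))
  have p_ge: "p0 \<le> p x" if "x \<in> \<Omega>" for x
    using ess_inf_on_gt_imp_ge[OF \<Omega> cont(3) p0(2) that] .
  have r_ge: "1 \<le> r x" if "x \<in> \<Omega>" for x
  proof (rule dense_le)
    fix z :: real assume "z < 1"
    then have "ereal z < ess_inf_on \<Omega> r"
      using assms(10) unfolding one_ereal_def by (metis less_ereal.simps(1) less_le_trans)
    then show "z \<le> r x" by (rule ess_inf_on_gt_imp_ge[OF \<Omega> cont(2) _ that])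
  qed
  from assms(11) obtain a0 where a0: "0 < a0" "ereal a0 < ess_inf_on \<Omega> \<alpha>"
    unfolding zero_ereal_def by (metis ereal_dense2 less_ereal.simps(1))
  have \<alpha>_ge: "a0 \<le> \<alpha> x" if "x \<in> \<Omega>" for x
    using ess_inf_on_gt_imp_ge[OF \<Omega> cont(1) a0(2) that] .
  from assms(13) obtain n0 where n0: "ess_sup_on \<Omega> (\<lambda>x. \<alpha> x * p x * r x) < ereal n0" "n0 < n"
    unfolding n_def by (metis ereal_dense2 less_ereal.simps(1))
  define d0 where "d0 = n - n0"
  have d0: "d0 > 0" using n0 by (simp add: d0_def)
  have gap: "d0 \<le> n - \<alpha> x * p x * r x" if "x \<in> \<Omega>" for x
  proof -
    have "continuous_on \<Omega> (\<lambda>x. \<alpha> x * p x * r x)"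
      by (intro continuous_intros cont)
    from ess_sup_on_lt_imp_le[OF \<Omega> this n0(1) that] show ?thesis by (simp add: d0_def)
  qed
  from assms(4) obtain r1 where r1: "r1 > 0" "\<And>x. x \<in> \<Omega> \<Longrightarrow> \<bar>r x\<bar> \<le> r1"
    unfolding bounded_pos by auto
  from assms(5) obtain p1 where p1: "p1 > 0" "\<And>x. x \<in> \<Omega> \<Longrightarrow> \<bar>p x\<bar> \<le> p1"
    unfolding bounded_pos by auto
  from assms(3) obtain a1 where a1: "a1 > 0" "\<And>x. x \<in> \<Omega> \<Longrightarrow> \<bar>\<alpha> x\<bar> \<le> a1"
    unfolding bounded_pos by auto

  have q_ge: "p0 - 1 \<le> q x" if x: "x \<in> \<Omega>" for x
  proof -
    have gx: "0 < n - \<alpha> x * p x * r x" using gap[OF x] d0 by linarith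
    have "0 \<le> \<alpha> x * p x * r x"
      using \<alpha>_ge[OF x] a0 p_ge[OF x] p0 r_ge[OF x] by simp
    then have "(p0 - 1) * (n - \<alpha> x * p x * r x) \<le> (p0 - 1) * n"
      using p0 by (intro mult_left_mono) auto
    also have "\<dots> \<le> (r x * (p x - 1)) * n"
    proof (intro mult_right_mono)
      have "1 * (p0 - 1) \<le> r x * (p x - 1)"
        using r_ge[OF x] p_ge[OF x] p0 by (intro mult_mono) auto
      then show "p0 - 1 \<le> r x * (p x - 1)" by simp
    qed (use n in simp)
    finally show ?thesis using gx by (simp add: q_def pos_le_divide_eq mult_ac)
  qed
  have q_lh: "log_holder_on \<Omega> q"
  proof -
    have ap_bd: "bounded ((\<lambda>x. \<alpha> x * p x) ` \<Omega>)"
      using a1 p1 by (intro boundedI[of _ "a1 * p1"]) (auto simp: abs_mult intro!: mult_mono)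
    have ap: "log_holder_on \<Omega> (\<lambda>x. \<alpha> x * p x)" and rp: "log_holder_on \<Omega> (\<lambda>x. r x * p x)"
      using assms by (auto intro!: log_holder_on_mult)
    have apr: "log_holder_on \<Omega> (\<lambda>x. \<alpha> x * p x * r x)"
      using ap assms ap_bd by (intro log_holder_on_mult) auto
    have "log_holder_on \<Omega> (\<lambda>x. n - \<alpha> x * p x * r x)"
    proof (rule log_holder_on_dominated[OF apr apr, of 1])
      have "\<bar>(n - a) - (n - b)\<bar> \<le> 1 * (\<bar>a - b\<bar> + \<bar>a - b\<bar>)" for a b
        by (simp add: abs_if)
      then show "\<bar>(n - \<alpha> x * p x * r x) - (n - \<alpha> y * p y * r y)\<bar>
          \<le> 1 * (\<bar>\<alpha> x * p x * r x - \<alpha> y * p y * r y\<bar> + \<bar>\<alpha> x * p x * r x - \<alpha> y * p y * r y\<bar>)" for x y .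
    qed simp
    moreover have "log_holder_on \<Omega> (\<lambda>x. n * r x * (p x - 1))"
    proof (rule log_holder_on_dominated[OF rp assms(7), of n])
      fix x y
      have "n * r x * (p x - 1) - n * r y * (p y - 1) = n * ((r x * p x - r y * p y) - (r x - r y))"
        by (simp add: algebra_simps)
      also have "\<bar>\<dots>\<bar> \<le> n * (\<bar>r x * p x - r y * p y\<bar> + \<bar>r x - r y\<bar>)"
        using n by (simp add: abs_mult)
      finally show "\<bar>n * r x * (p x - 1) - n * r y * (p y - 1)\<bar> \<le> n * (\<bar>r x * p x - r y * p y\<bar> + \<bar>r x - r y\<bar>)" .
    qed (use n in simp)
    moreover have "bounded ((\<lambda>x. n * r x * (p x - 1)) ` \<Omega>)"
    proof (rule boundedI)
      fix v assume "v \<in> (\<lambda>x. n * r x * (p x - 1)) ` \<Omega>"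
      then obtain x where x: "x \<in> \<Omega>" "v = n * r x * (p x - 1)" by blast
      have "\<bar>p x - 1\<bar> \<le> p1 + 1" using p1(2)[OF x(1)] by linarith
      then show "norm v \<le> n * r1 * (p1 + 1)"
        unfolding x(2) using r1(2)[OF x(1)] r1(1) n by (auto simp: abs_mult intro!: mult_mono)
    qed
    ultimately show ?thesis
      unfolding q_def using gap d0 by (intro log_holder_on_divide)
  qed

  define u where "u = zero_extend \<Omega> f"
  have f_meas: "f \<in> borel_measurable (lebesgue_on \<Omega>)" and f_fin: "var_modular \<Omega> r f < \<infinity>"
    using assms(15) by (auto simp: var_Lebesgue_def)
  have u_eq: "u = (\<lambda>x. f x * indicator \<Omega> x)"
    by (auto simp: u_def zero_extend_def indicator_def)
  have u[measurable]: "u \<in> borel_measurable lebesgue"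
    unfolding u_eq using f_meas \<Omega>_sets by (subst borel_measurable_restrict_space_iff_ereal[symmetric]) auto
  have u0: "u y = 0" if "y \<notin> \<Omega>" for y
    using that by (simp add: u_def zero_extend_def)
  define G where "G y = epowr (e2ennreal \<bar>u y\<bar>) (indicator \<Omega> y * r y) * indicator \<Omega> y" for y
  have "(\<lambda>y. indicator \<Omega> y * r y) \<in> borel_measurable lebesgue"
    using borel_measurable_indicator_times_continuous[OF \<Omega> cont(2)]
    by (intro measurable_completion) simp
  then have G: "G \<in> borel_measurable lebesgue"
    unfolding G_def using \<Omega>_sets by measurable
  have G_eq: "G y = epowr (e2ennreal \<bar>u y\<bar>) (r y)" if "y \<in> \<Omega>" for y
    using that by (simp add: G_def)
  have G_int: "(\<integral>\<^sup>+y. G y \<partial>lebesgue) = var_modular \<Omega> r f"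
    unfolding var_modular_def using \<Omega>_sets
    by (subst nn_integral_restrict_space)
       (auto simp: G_def u_def zero_extend_def indicator_def intro!: nn_integral_cong)
  define K where "K = max 1 (enn2real (var_modular \<Omega> r f))"
  have K: "1 \<le> K" by (simp add: K_def)
  have "var_modular \<Omega> r f = ennreal (enn2real (var_modular \<Omega> r f))"
    using f_fin by (simp add: less_top)
  also have "\<dots> \<le> ennreal K" by (intro ennreal_leI) (simp add: K_def)
  finally have G_le: "(\<integral>\<^sup>+y. G y \<partial>lebesgue) \<le> ennreal K" by (simp add: G_int)

  define W where "W x = wolff_potential u (\<alpha> x) (p x) x" for x
  have W: "W \<in> borel_measurable (lebesgue_on \<Omega>)"
    unfolding W_def using \<Omega> cont u by (intro borel_measurable_wolff_potential)

  obtain c where c: "c > 0"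
    and W_le: "\<And>x l. x \<in> \<Omega> \<Longrightarrow> 1 \<le> l \<Longrightarrow>
      (\<And>\<rho>. \<rho> > 0 \<Longrightarrow> (\<integral>\<^sup>+y\<in>ball x \<rho>. G y \<partial>lebesgue) \<le> ennreal (l powr q x * \<rho> powr n)) \<Longrightarrow>
      W x \<le> ennreal (c * l)"
  proof -
    have "r x \<le> r1" "p x \<le> p1" if "x \<in> \<Omega>" for x
      using r1(2)[OF that] p1(2)[OF that] by auto
    then show ?thesis
      using wolff_potential_le_of_modular_density[OF assms(2,7) r_ge _ p0(1) p_ge _ a0(1) \<alpha>_ge d0
          gap[unfolded n_def] u u0 G G_eq K G_le, of r1 p1] that
      unfolding q_def n_def W_def by blast
  qed
  obtain C where C: "C > 0"
    and weak: "\<And>G E l. G \<in> borel_measurable lebesgue \<Longrightarrow> (\<integral>\<^sup>+y. G y \<partial>lebesgue) \<le> ennreal K \<Longrightarrow>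
      E \<subseteq> \<Omega> \<Longrightarrow> 1 \<le> l \<Longrightarrow>
      (\<And>x. x \<in> E \<Longrightarrow> \<exists>\<rho>>0. ennreal (l powr q x * \<rho> powr n) \<le> (\<integral>\<^sup>+y\<in>ball x \<rho>. G y \<partial>lebesgue)) \<Longrightarrow>
      (\<integral>\<^sup>+x\<in>E. ennreal (l powr q x) \<partial>lebesgue) \<le> ennreal C"
  proof -
    have "0 < p0 - 1" using p0(1) by simp
    then show ?thesis
    proof (rule variable_exponent_weak_type[OF q_lh _ q_ge K, folded n_def])
      fix C :: real
      assume "C > 0" and *: "\<And>G E t. G \<in> borel_measurable lebesgue \<Longrightarrow>
        (\<integral>\<^sup>+y. G y \<partial>lebesgue) \<le> ennreal K \<Longrightarrow> E \<subseteq> \<Omega> \<Longrightarrow> 1 \<le> t \<Longrightarrow>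
        (\<And>x. x \<in> E \<Longrightarrow> \<exists>\<rho>>0. ennreal (t powr q x * \<rho> powr n) \<le> (\<integral>\<^sup>+y\<in>ball x \<rho>. G y \<partial>lebesgue)) \<Longrightarrow>
        (\<integral>\<^sup>+x\<in>E. ennreal (t powr q x) \<partial>lebesgue) \<le> ennreal C"
      show ?thesis by (rule that[OF \<open>C > 0\<close> *])
    qed
  qed

  have \<Omega>_fin: "emeasure lebesgue \<Omega> = ennreal (measure lebesgue \<Omega>)"
    using \<Omega> \<open>bounded \<Omega>\<close> by (intro emeasure_eq_ennreal_measure) (metis bounded_set_imp_lmeasurable fmeasurableD2 \<Omega>_sets)
  define T where "T = 1 + C + measure lebesgue \<Omega>"
  have "(\<lambda>x. enn2ereal (W x)) \<in> weak_var_Lebesgue \<Omega> q"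
  proof (rule weak_var_Lebesgue_memI[OF \<Omega>_sets _ _ _ q_ge c])
    show "(\<lambda>x. enn2ereal (W x)) \<in> borel_measurable (lebesgue_on \<Omega>)" using W by measurable
    show "q \<in> borel_measurable (lebesgue_on \<Omega>)"
      using log_holder_on_imp_continuous_on[OF q_lh] \<Omega>_sets
      by (rule continuous_imp_measurable_on_sets_lebesgue)
    show "0 < p0 - 1" using p0 by simp
    show "1 \<le> T" using C by (simp add: T_def)
    fix l :: real assume l: "l > 0"
    define E where "E = {x \<in> \<Omega>. ereal l < \<bar>enn2ereal (W x)\<bar>}"
    show "(\<integral>\<^sup>+x\<in>{x \<in> \<Omega>. ereal l < \<bar>enn2ereal (W x)\<bar>}. ennreal ((l / c) powr q x) \<partial>lebesgue) \<le> ennreal T"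
    proof (cases "1 \<le> l / c")
      case True
      have "(\<integral>\<^sup>+x\<in>E. ennreal ((l / c) powr q x) \<partial>lebesgue) \<le> ennreal C"
      proof (rule weak[OF G G_le _ True])
        show "E \<subseteq> \<Omega>" by (auto simp: E_def)
        fix x assume x: "x \<in> E"
        show "\<exists>\<rho>>0. ennreal ((l / c) powr q x * \<rho> powr n) \<le> (\<integral>\<^sup>+y\<in>ball x \<rho>. G y \<partial>lebesgue)"
        proof (rule ccontr)
          assume "\<not> ?thesis"
          then have "W x \<le> ennreal (c * (l / c))"
            using x by (intro W_le[OF _ True]) (auto simp: E_def not_le intro: less_imp_le)
          then have "W x \<le> ennreal l" using c by simp
          then have "enn2ereal (W x) \<le> enn2ereal (ennreal l)" by (simp add: less_eq_ennreal.rep_eq)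
          then have "enn2ereal (W x) \<le> ereal l" using l by (simp add: enn2ereal_ennreal)
          then show False using x by (simp add: E_def not_le[symmetric])
        qed
      qed
      also have "\<dots> \<le> ennreal T" by (intro ennreal_leI) (simp add: T_def)
      finally show ?thesis by (simp add: E_def)
    next
      case False
      \<comment> \<open>small levels: the integrand is at most \<open>1\<close> and \<open>\<Omega>\<close> has finite measure\<close>
      have "(\<integral>\<^sup>+x\<in>E. ennreal ((l / c) powr q x) \<partial>lebesgue) \<le> (\<integral>\<^sup>+x. indicator \<Omega> x \<partial>lebesgue)"
      proof (intro nn_integral_mono)
        fix x
        show "ennreal ((l / c) powr q x) * indicator E x \<le> indicator \<Omega> x"
        proof (cases "x \<in> E")
          case True
          then have x: "x \<in> \<Omega>" by (simp add: E_def)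
          have "(l / c) powr q x \<le> 1"
            using False l c q_ge[OF x] p0(1) by (intro powr_le1) auto
          then show ?thesis using x True by simp
        qed simp
      qed
      also have "\<dots> = ennreal (measure lebesgue \<Omega>)"
        using \<Omega>_sets \<Omega>_fin by simp
      also have "\<dots> \<le> ennreal T" using C by (intro ennreal_leI) (simp add: T_def)
      finally show ?thesis by (simp add: E_def)
    qed
  qed
  then show ?thesis
    unfolding W_def q_def n_def u_def .
qed

end
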